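(* The contour category construction $\mathcal{C}[-]:\mathrm{Operad}\to\mathrm{Cat}$ is left adjoint to the spliced arrows functor $\mathcal{W}[-]:\mathrm{Cat}\to\mathrm{Operad}$. The unit at an operad $\mathcal{O}$ is the functor of operads $\mathcal{O}\to\mathcal{W}[\mathcal{C}[\mathcal{O}]]$ sending a color $R$ to $(R^u,R^d)$ and an operation $f:R_1,\dots,R_n\to R$ to $(f,0){-}(f,1){-}\cdots{-}(f,n)$. The counit at a category $\mathcal{C}$ is the functor $\mathcal{C}[\mathcal{W}[\mathcal{C}]]\to\mathcal{C}$ sending $(A,B)^u\mapsto A$, $(A,B)^d\mapsto B$ and $(w_0{-}\cdots{-}w_n,\,i)\mapsto w_i$.
   Context: Composition of arrows in categories is written in diagrammatic order. "Operad" means colored non-symmetric operad (multicategory); $f\circ_i g$ denotes partial composition of $g$ into $f$ after the first $i$ inputs of $f$ (so $0\le i<\mathrm{arity}(f)$). $\mathrm{Operad}$ is the category of operads and functors of operads (maps of colors and operations preserving types, identities and composition); $\mathrm{Cat}$ is the category of small categories. The operad $\mathcal{W}[\mathcal{C}]$ of spliced arrows of a category $\mathcal{C}$ has as colors the pairs $(A,B)$ of objects of $\mathcal{C}$; an $n$-ary operation $(A_1,B_1),\dots,(A_n,B_n)\to(A,B)$ is a sequence $w_0{-}w_1{-}\cdots{-}w_n$ of $n+1$ arrows $w_i:B_i\to A_{i+1}$ of $\mathcal{C}$ ($0\le i\le n$, with $B_0=A$, $A_{n+1}=B$). Partial composition $f\circ_i g$ substitutes the sequence $g$ for the $i$-th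 gap "$-$" of $f$ (0-indexed from the left), interpreting juxtaposition as composition in $\mathcal{C}$; the identity on $(A,B)$ is $\mathrm{id}_A{-}\mathrm{id}_B$. A functor $F:\mathcal{C}\to\mathcal{D}$ induces $\mathcal{W}[F]$ by $(A,B)\mapsto(FA,FB)$ and $w_0{-}\cdots{-}w_n\mapsto Fw_0{-}\cdots{-}Fw_n$. The contour category $\mathcal{C}[\mathcal{O}]$ of an operad $\mathcal{O}$ has objects $R^u$ and $R^d$ for each color $R$ of $\mathcal{O}$. Its arrows are generated by pairs $(f,i)$ of an operation $f:R_1,\dots,R_n\to R$ of $\mathcal{O}$ and an index $0\le i\le n$, giving an arrow $(f,i):R_i^d\to R_{i+1}^u$ under the conventions $R_0^d=R^u$, $R_{n+1}^u=R^d$; these are subject to $\mathrm{id}_{R^u}=(\mathrm{id}_R,0)$, $\mathrm{id}_{R^d}=(\mathrm{id}_R,1)$, and, for every operation $f$, every operation $g$ of arity $m>0$, every constant $c$, and all indices $i,j$ for which the left-hand side is well-formed: $$(f\circ_i g,j)=\begin{cases}(f,j)& j<i\\(f,i)(g,0)& j=i\\(g,j-i)& i<j<i+m\\(g,m)(f,i+1)& j=i+m\\(f,j-m+1)& j>i+m\end{cases}\qquad (f\circ_i c,j)=\begin{cases}(f,j)& j<i\\(f,i)(c,0)(f,i+1)& j=i\\(f,j+1)& j>i.\end{cases}$$ A functor of operads $F:\mathcal{O}\to\mathcal{P}$ induces $\mathcal{C}[F]:\mathcal{C}[\mathcal{O}]\to\mathcal{C}[\mathcal{P}]$ by $R^\epsilon\mapsto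 F(R)^\epsilon$, $(f,i)\mapsto(F(f),i)$. *)

theory Defs
  imports Main "HOL-Library.FuncSet"
begin

section \<open>Small categories and functors\<close>

text \<open>\<open>Comp C f g\<close> is the composite in diagrammatic order: first \<open>f\<close>, then \<open>g\<close>.\<close>

record ('o, 'a) cat_data =
  Obj :: "'o set"
  Arr :: "'a set"
  Dom :: "'a \<Rightarrow> 'o"
  Cod :: "'a \<Rightarrow> 'o"
  Idn :: "'o \<Rightarrow> 'a"
  Comp :: "'a \<Rightarrow> 'a \<Rightarrow> 'a"

locale category =
  fixes \<C> :: "('o, 'a) cat_data"
  assumes Dom_Obj: "f \<in> Arr \<C> \<Longrightarrow> Dom \<C> f \<in> Obj \<C>"
    and Cod_Obj: "f \<in> Arr \<C> \<Longrightarrow> Cod \<C> f \<in> Obj \<C>"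
    and Idn_Arr: "A \<in> Obj \<C> \<Longrightarrow> Idn \<C> A \<in> Arr \<C>"
    and Dom_Idn: "A \<in> Obj \<C> \<Longrightarrow> Dom \<C> (Idn \<C> A) = A"
    and Cod_Idn: "A \<in> Obj \<C> \<Longrightarrow> Cod \<C> (Idn \<C> A) = A"
    and Comp_Arr: "\<lbrakk>f \<in> Arr \<C>; g \<in> Arr \<C>; Cod \<C> f = Dom \<C> g\<rbrakk> \<Longrightarrow> Comp \<C> f g \<in> Arr \<C>"
    and Dom_Comp: "\<lbrakk>f \<in> Arr \<C>; g \<in> Arr \<C>; Cod \<C> f = Dom \<C> g\<rbrakk> \<Longrightarrow> Dom \<C> (Comp \<C> f g) = Dom \<C> f"
    and Cod_Comp: "\<lbrakk>f \<in> Arr \<C>; g \<in> Arr \<C>; Cod \<C> f = Dom \<C> g\<rbrakk> \<Longrightarrow> Cod \<C> (Comp \<C> f g) = Cod \<C> g"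
    and Idn_left: "f \<in> Arr \<C> \<Longrightarrow> Comp \<C> (Idn \<C> (Dom \<C> f)) f = f"
    and Idn_right: "f \<in> Arr \<C> \<Longrightarrow> Comp \<C> f (Idn \<C> (Cod \<C> f)) = f"
    and Comp_assoc:
      "\<lbrakk>f \<in> Arr \<C>; g \<in> Arr \<C>; h \<in> Arr \<C>; Cod \<C> f = Dom \<C> g; Cod \<C> g = Dom \<C> h\<rbrakk>
        \<Longrightarrow> Comp \<C> (Comp \<C> f g) h = Comp \<C> f (Comp \<C> g h)"

text \<open>Functors are required to be extensional (\<open>undefined\<close> outside the source), so that
  HOL equality of functors with a given source and target is equality of functors.\<close>

record ('o, 'a, 'p, 'b) functor_data =
  on_obj :: "'o \<Rightarrow> 'p"
  on_arr :: "'a \<Rightarrow> 'b"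

locale category_functor = source: category \<C> + target: category \<D>
  for \<C> :: "('o, 'a) cat_data" and \<D> :: "('p, 'b) cat_data" +
  fixes F :: "('o, 'a, 'p, 'b) functor_data"
  assumes on_obj: "on_obj F \<in> Obj \<C> \<rightarrow>\<^sub>E Obj \<D>"
    and on_arr: "on_arr F \<in> Arr \<C> \<rightarrow>\<^sub>E Arr \<D>"
    and map_Dom: "f \<in> Arr \<C> \<Longrightarrow> Dom \<D> (on_arr F f) = on_obj F (Dom \<C> f)"
    and map_Cod: "f \<in> Arr \<C> \<Longrightarrow> Cod \<D> (on_arr F f) = on_obj F (Cod \<C> f)"
    and map_Idn: "A \<in> Obj \<C> \<Longrightarrow> on_arr F (Idn \<C> A) = Idn \<D> (on_obj F A)"
    and map_Comp: "\<lbrakk>f \<in> Arr \<C>; g \<in> Arr \<C>; Cod \<C> f = Dom \<C> g\<rbrakk>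
      \<Longrightarrow> on_arr F (Comp \<C> f g) = Comp \<D> (on_arr F f) (on_arr F g)"

definition id_functor :: "('o, 'a) cat_data \<Rightarrow> ('o, 'a, 'o, 'a) functor_data" where
  "id_functor \<C> = \<lparr>on_obj = (\<lambda>A\<in>Obj \<C>. A), on_arr = (\<lambda>f\<in>Arr \<C>. f)\<rparr>"

text \<open>\<open>comp_functor \<C> F G\<close> is first \<open>F\<close>, then \<open>G\<close>, where \<open>\<C>\<close> is the source of \<open>F\<close>.\<close>

definition comp_functor ::
  "('o, 'a) cat_data \<Rightarrow> ('o, 'a, 'p, 'b) functor_data \<Rightarrow> ('p, 'b, 'q, 'c) functor_data
    \<Rightarrow> ('o, 'a, 'q, 'c) functor_data" where
  "comp_functor \<C> F G =
    \<lparr>on_obj = compose (Obj \<C>) (on_obj G) (on_obj F),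
     on_arr = compose (Arr \<C>) (on_arr G) (on_arr F)\<rparr>"


section \<open>Colored non-symmetric operads and their functors\<close>

text \<open>\<open>Pcomp P f i g\<close> is the partial composition \<open>f \<circ>\<^sub>i g\<close>, with \<open>0 \<le> i < arity f\<close>.\<close>

record ('c, 'f) operad_data =
  Col :: "'c set"
  Ops :: "'f set"
  Ins :: "'f \<Rightarrow> 'c list"
  Out :: "'f \<Rightarrow> 'c"
  Oid :: "'c \<Rightarrow> 'f"
  Pcomp :: "'f \<Rightarrow> nat \<Rightarrow> 'f \<Rightarrow> 'f"

definition arity :: "('c, 'f) operad_data \<Rightarrow> 'f \<Rightarrow> nat" where
  "arity \<O> f = length (Ins \<O> f)"

definition composable :: "('c, 'f) operad_data \<Rightarrow> 'f \<Rightarrow> nat \<Rightarrow> 'f \<Rightarrow> bool" where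
  "composable \<O> f i g \<longleftrightarrow>
    f \<in> Ops \<O> \<and> g \<in> Ops \<O> \<and> i < arity \<O> f \<and> Out \<O> g = Ins \<O> f ! i"

locale operad =
  fixes \<O> :: "('c, 'f) operad_data"
  assumes Ins_Col: "f \<in> Ops \<O> \<Longrightarrow> set (Ins \<O> f) \<subseteq> Col \<O>"
    and Out_Col: "f \<in> Ops \<O> \<Longrightarrow> Out \<O> f \<in> Col \<O>"
    and Oid_Ops: "R \<in> Col \<O> \<Longrightarrow> Oid \<O> R \<in> Ops \<O>"
    and Ins_Oid: "R \<in> Col \<O> \<Longrightarrow> Ins \<O> (Oid \<O> R) = [R]"
    and Out_Oid: "R \<in> Col \<O> \<Longrightarrow> Out \<O> (Oid \<O> R) = R"
    and Pcomp_Ops: "composable \<O> f i g \<Longrightarrow> Pcomp \<O> f i g \<in> Ops \<O>"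
    and Ins_Pcomp: "composable \<O> f i g \<Longrightarrow>
      Ins \<O> (Pcomp \<O> f i g) = take i (Ins \<O> f) @ Ins \<O> g @ drop (Suc i) (Ins \<O> f)"
    and Out_Pcomp: "composable \<O> f i g \<Longrightarrow> Out \<O> (Pcomp \<O> f i g) = Out \<O> f"
    and Oid_left: "f \<in> Ops \<O> \<Longrightarrow> Pcomp \<O> (Oid \<O> (Out \<O> f)) 0 f = f"
    and Oid_right: "\<lbrakk>f \<in> Ops \<O>; i < arity \<O> f\<rbrakk> \<Longrightarrow> Pcomp \<O> f i (Oid \<O> (Ins \<O> f ! i)) = f"
    and Pcomp_sequential: "\<lbrakk>composable \<O> f i g; composable \<O> g j h\<rbrakk> \<Longrightarrow>
      Pcomp \<O> (Pcomp \<O> f i g) (i + j) h = Pcomp \<O> f i (Pcomp \<O> g j h)"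
    and Pcomp_parallel: "\<lbrakk>composable \<O> f i g; composable \<O> f j h; i < j\<rbrakk> \<Longrightarrow>
      Pcomp \<O> (Pcomp \<O> f i g) (j + arity \<O> g - 1) h = Pcomp \<O> (Pcomp \<O> f j h) i g"

record ('c, 'f, 'd, 'g) operad_functor_data =
  on_col :: "'c \<Rightarrow> 'd"
  on_ops :: "'f \<Rightarrow> 'g"

locale operad_functor = source: operad \<O> + target: operad \<P>
  for \<O> :: "('c, 'f) operad_data" and \<P> :: "('d, 'g) operad_data" +
  fixes F :: "('c, 'f, 'd, 'g) operad_functor_data"
  assumes on_col: "on_col F \<in> Col \<O> \<rightarrow>\<^sub>E Col \<P>"
    and on_ops: "on_ops F \<in> Ops \<O> \<rightarrow>\<^sub>E Ops \<P>"
    and map_Ins: "f \<in> Ops \<O> \<Longrightarrow> Ins \<P> (on_ops F f) = map (on_col F) (Ins \<O> f)"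
    and map_Out: "f \<in> Ops \<O> \<Longrightarrow> Out \<P> (on_ops F f) = on_col F (Out \<O> f)"
    and map_Oid: "R \<in> Col \<O> \<Longrightarrow> on_ops F (Oid \<O> R) = Oid \<P> (on_col F R)"
    and map_Pcomp: "composable \<O> f i g \<Longrightarrow>
      on_ops F (Pcomp \<O> f i g) = Pcomp \<P> (on_ops F f) i (on_ops F g)"

definition id_operad_functor ::
  "('c, 'f) operad_data \<Rightarrow> ('c, 'f, 'c, 'f) operad_functor_data" where
  "id_operad_functor \<O> = \<lparr>on_col = (\<lambda>R\<in>Col \<O>. R), on_ops = (\<lambda>f\<in>Ops \<O>. f)\<rparr>"

definition comp_operad_functor ::
  "('c, 'f) operad_data \<Rightarrow> ('c, 'f, 'd, 'g) operad_functor_data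
    \<Rightarrow> ('d, 'g, 'e, 'h) operad_functor_data \<Rightarrow> ('c, 'f, 'e, 'h) operad_functor_data" where
  "comp_operad_functor \<O> F G =
    \<lparr>on_col = compose (Col \<O>) (on_col G) (on_col F),
     on_ops = compose (Ops \<O>) (on_ops G) (on_ops F)\<rparr>"


section \<open>The operad of spliced arrows\<close>

text \<open>The sequence \<open>w\<^sub>0-w\<^sub>1-\<dots>-w\<^sub>n\<close> is the list \<open>[w\<^sub>0, \<dots>, w\<^sub>n]\<close>. Since arrows determine their
  endpoints, the colors of the gaps and of the output are recovered from the list: the \<open>i\<close>-th
  gap is \<open>(Cod w\<^sub>i, Dom w\<^sub>i\<^sub>+\<^sub>1)\<close>, and every nonempty list of arrows is an operation.\<close>

definition splice_comp ::
  "('o, 'a) cat_data \<Rightarrow> 'a list \<Rightarrow> nat \<Rightarrow> 'a list \<Rightarrow> 'a list" where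
  "splice_comp \<C> w i v =
    take i w
    @ (if length v = 1
       then [Comp \<C> (Comp \<C> (w ! i) (hd v)) (w ! Suc i)]
       else [Comp \<C> (w ! i) (hd v)] @ butlast (tl v) @ [Comp \<C> (last v) (w ! Suc i)])
    @ drop (i + 2) w"

definition spliced :: "('o, 'a) cat_data \<Rightarrow> ('o \<times> 'o, 'a list) operad_data" where
  "spliced \<C> =
    \<lparr>Col = Obj \<C> \<times> Obj \<C>,
     Ops = {w. w \<noteq> [] \<and> set w \<subseteq> Arr \<C>},
     Ins = (\<lambda>w. zip (map (Cod \<C>) (butlast w)) (map (Dom \<C>) (tl w))),
     Out = (\<lambda>w. (Dom \<C> (hd w), Cod \<C> (last w))),
     Oid = (\<lambda>(A, B). [Idn \<C> A, Idn \<C> B]),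
     Pcomp = splice_comp \<C>\<rparr>"

definition splice_map ::
  "('o, 'a) cat_data \<Rightarrow> ('o, 'a, 'p, 'b) functor_data
    \<Rightarrow> ('o \<times> 'o, 'a list, 'p \<times> 'p, 'b list) operad_functor_data" where
  "splice_map \<C> F =
    \<lparr>on_col = (\<lambda>(A, B)\<in>Col (spliced \<C>). (on_obj F A, on_obj F B)),
     on_ops = (\<lambda>w\<in>Ops (spliced \<C>). map (on_arr F) w)\<rparr>"


section \<open>The contour category of an operad\<close>

text \<open>\<open>Up R\<close> and \<open>Down R\<close> are the objects written \<open>R\<^sup>u\<close> and \<open>R\<^sup>d\<close>.\<close>

datatype 'c contour_obj = Up 'c | Down 'c

definition contour_objs :: "('c, 'f) operad_data \<Rightarrow> 'c contour_obj set" where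
  "contour_objs \<O> = Up ` Col \<O> \<union> Down ` Col \<O>"

definition contour_gens :: "('c, 'f) operad_data \<Rightarrow> ('f \<times> nat) set" where
  "contour_gens \<O> = {(f, i). f \<in> Ops \<O> \<and> i \<le> arity \<O> f}"

text \<open>The paper numbers the inputs of \<open>f\<close> as \<open>R\<^sub>1, \<dots>, R\<^sub>n\<close>, so \<open>R\<^sub>i\<close> is \<open>Ins \<O> f ! (i - 1)\<close>.\<close>

fun gen_dom :: "('c, 'f) operad_data \<Rightarrow> 'f \<times> nat \<Rightarrow> 'c contour_obj" where
  "gen_dom \<O> (f, i) = (if i = 0 then Up (Out \<O> f) else Down (Ins \<O> f ! (i - 1)))"

fun gen_cod :: "('c, 'f) operad_data \<Rightarrow> 'f \<times> nat \<Rightarrow> 'c contour_obj" where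
  "gen_cod \<O> (f, i) = (if i = arity \<O> f then Down (Out \<O> f) else Up (Ins \<O> f ! i))"

text \<open>Arrows of the contour category are paths of generators, recorded with their endpoints,
  modulo the congruence generated by the relations.\<close>

type_synonym ('c, 'f) contour_path = "'c contour_obj \<times> ('f \<times> nat) list \<times> 'c contour_obj"

primrec is_path ::
  "('c, 'f) operad_data \<Rightarrow> 'c contour_obj \<Rightarrow> ('f \<times> nat) list \<Rightarrow> 'c contour_obj \<Rightarrow> bool" where
  "is_path \<O> x [] y \<longleftrightarrow> x \<in> contour_objs \<O> \<and> x = y"
| "is_path \<O> x (e # es) y \<longleftrightarrow>
    e \<in> contour_gens \<O> \<and> x = gen_dom \<O> e \<and> is_path \<O> (gen_cod \<O> e) es y"

definition contour_paths :: "('c, 'f) operad_data \<Rightarrow> ('c, 'f) contour_path set" where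
  "contour_paths \<O> = {(x, es, y). is_path \<O> x es y}"

text \<open>The right-hand side of the relation for \<open>(f \<circ>\<^sub>i g, j)\<close>.\<close>

definition contour_rhs ::
  "('c, 'f) operad_data \<Rightarrow> 'f \<Rightarrow> nat \<Rightarrow> 'f \<Rightarrow> nat \<Rightarrow> ('f \<times> nat) list" where
  "contour_rhs \<O> f i g j =
    (let m = arity \<O> g in
     if m > 0 then
       (if j < i then [(f, j)]
        else if j = i then [(f, i), (g, 0)]
        else if j < i + m then [(g, j - i)]
        else if j = i + m then [(g, m), (f, i + 1)]
        else [(f, j - m + 1)])
     else
       (if j < i then [(f, j)]
        else if j = i then [(f, i), (g, 0), (f, i + 1)]
        else [(f, j + 1)]))"

inductive_set contour_cong ::
  "('c, 'f) operad_data \<Rightarrow> (('c, 'f) contour_path \<times> ('c, 'f) contour_path) set"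
  for \<O> :: "('c, 'f) operad_data" where
  refl: "p \<in> contour_paths \<O> \<Longrightarrow> (p, p) \<in> contour_cong \<O>"
| sym: "(p, q) \<in> contour_cong \<O> \<Longrightarrow> (q, p) \<in> contour_cong \<O>"
| trans: "\<lbrakk>(p, q) \<in> contour_cong \<O>; (q, r) \<in> contour_cong \<O>\<rbrakk> \<Longrightarrow> (p, r) \<in> contour_cong \<O>"
| append: "\<lbrakk>((x, es, y), (x, es', y)) \<in> contour_cong \<O>; ((y, ds, z), (y, ds', z)) \<in> contour_cong \<O>\<rbrakk>
    \<Longrightarrow> ((x, es @ ds, z), (x, es' @ ds', z)) \<in> contour_cong \<O>"
| id_up: "R \<in> Col \<O> \<Longrightarrow> ((Up R, [], Up R), (Up R, [(Oid \<O> R, 0)], Up R)) \<in> contour_cong \<O>"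
| id_down: "R \<in> Col \<O> \<Longrightarrow> ((Down R, [], Down R), (Down R, [(Oid \<O> R, 1)], Down R)) \<in> contour_cong \<O>"
| pcomp: "\<lbrakk>composable \<O> f i g; j \<le> arity \<O> (Pcomp \<O> f i g);
      x = gen_dom \<O> (Pcomp \<O> f i g, j); y = gen_cod \<O> (Pcomp \<O> f i g, j)\<rbrakk>
    \<Longrightarrow> ((x, [(Pcomp \<O> f i g, j)], y), (x, contour_rhs \<O> f i g j, y)) \<in> contour_cong \<O>"

definition contour_class ::
  "('c, 'f) operad_data \<Rightarrow> ('c, 'f) contour_path \<Rightarrow> ('c, 'f) contour_path set" where
  "contour_class \<O> p = contour_cong \<O> `` {p}"

text \<open>\<open>class_val h X\<close> is the common value of \<open>h\<close> on an equivalence class \<open>X\<close>.\<close>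

definition class_val :: "('p \<Rightarrow> 'v) \<Rightarrow> 'p set \<Rightarrow> 'v" where
  "class_val h X = the_elem (h ` X)"

definition contour ::
  "('c, 'f) operad_data \<Rightarrow> ('c contour_obj, ('c, 'f) contour_path set) cat_data" where
  "contour \<O> =
    \<lparr>Obj = contour_objs \<O>,
     Arr = contour_paths \<O> // contour_cong \<O>,
     Dom = class_val (\<lambda>(x, es, y). x),
     Cod = class_val (\<lambda>(x, es, y). y),
     Idn = (\<lambda>x. contour_class \<O> (x, [], x)),
     Comp = (\<lambda>X Y. class_val
       (\<lambda>((x, es, y), (y', ds, z)). contour_class \<O> (x, es @ ds, z)) (X \<times> Y))\<rparr>"

definition contour_gen ::
  "('c, 'f) operad_data \<Rightarrow> 'f \<Rightarrow> nat \<Rightarrow> ('c, 'f) contour_path set" where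
  "contour_gen \<O> f i = contour_class \<O> (gen_dom \<O> (f, i), [(f, i)], gen_cod \<O> (f, i))"

text \<open>\<open>contour_map \<O> \<P> F\<close> is \<open>\<C>[F]\<close> for \<open>F : \<O> \<rightarrow> \<P>\<close>.\<close>

definition contour_map ::
  "('c, 'f) operad_data \<Rightarrow> ('d, 'g) operad_data \<Rightarrow> ('c, 'f, 'd, 'g) operad_functor_data
    \<Rightarrow> ('c contour_obj, ('c, 'f) contour_path set,
        'd contour_obj, ('d, 'g) contour_path set) functor_data" where
  "contour_map \<O> \<P> F =
    \<lparr>on_obj = (\<lambda>x\<in>Obj (contour \<O>). map_contour_obj (on_col F) x),
     on_arr = (\<lambda>X\<in>Arr (contour \<O>). class_val
       (\<lambda>(x, es, y). contour_class \<P>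
         (map_contour_obj (on_col F) x,
          map (\<lambda>(f, i). (on_ops F f, i)) es,
          map_contour_obj (on_col F) y)) X)\<rparr>"


section \<open>Unit and counit\<close>

definition contour_unit ::
  "('c, 'f) operad_data \<Rightarrow>
    ('c, 'f, 'c contour_obj \<times> 'c contour_obj, ('c, 'f) contour_path set list) operad_functor_data" where
  "contour_unit \<O> =
    \<lparr>on_col = (\<lambda>R\<in>Col \<O>. (Up R, Down R)),
     on_ops = (\<lambda>f\<in>Ops \<O>. map (contour_gen \<O> f) [0..<Suc (arity \<O> f)])\<rparr>"

fun counit_obj :: "('o \<times> 'o) contour_obj \<Rightarrow> 'o" where
  "counit_obj (Up (A, B)) = A"
| "counit_obj (Down (A, B)) = B"

text \<open>On a path of generators \<open>(w, i)\<close> the counit composes the arrows \<open>w ! i\<close>.\<close>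

definition contour_counit ::
  "('o, 'a) cat_data \<Rightarrow>
    (('o \<times> 'o) contour_obj, ('o \<times> 'o, 'a list) contour_path set, 'o, 'a) functor_data" where
  "contour_counit \<C> =
    \<lparr>on_obj = (\<lambda>x\<in>Obj (contour (spliced \<C>)). counit_obj x),
     on_arr = (\<lambda>X\<in>Arr (contour (spliced \<C>)). class_val
       (\<lambda>(x, es, y).
         foldl (Comp \<C>) (Idn \<C> (counit_obj x)) (map (\<lambda>(w, i). w ! i) es)) X)\<rparr>"

text \<open>The transpose of \<open>G : \<C>[\<O>] \<rightarrow> \<C>\<close>, which is the unit followed by \<open>\<W>[G]\<close>.\<close>

definition contour_transpose ::
  "('c, 'f) operad_data \<Rightarrow>
    ('c contour_obj, ('c, 'f) contour_path set, 'o, 'a) functor_data \<Rightarrow>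
    ('c, 'f, 'o \<times> 'o, 'a list) operad_functor_data" where
  "contour_transpose \<O> G =
    comp_operad_functor \<O> (contour_unit \<O>) (splice_map (contour \<O>) G)"

end

(* Splitting a sequence of arrows at a gap writes partial composition as
   f \<circ>\<^sub>i v = glue (glue p v) q, where f = p @ q and glue composes the last arrow of one
   sequence with the first arrow of the next. Gluing is associative, and this yields the operad axioms
   for spliced arrows. The relations of the contour category say precisely that
   f \<mapsto> (f,0)-...-(f,n) respects partial composition, so a functor of operads from O to the
   spliced arrows of C is the same as an assignment of arrows of C to the generators (f,i) that is
   compatible with the relations, hence the same as a functor from the contour category of O to C. Both
   contour_map and contour_counit are instances of this extension, and since a functor on
   the contour category is determined by its objects and generators, naturality and the triangle
   identities need only be checked there. *)
theory Submission
  imports Defs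
begin

section \<open>Composites of paths in a category\<close>

text \<open>The obstacle is that arrows of \<open>contour \<O>\<close> are equivalence classes, so a
  map out of them is a \<open>class_val\<close> that means something only once it is known to be
  constant on classes. For maps into another category that work is done a single time, in
  \<open>ext_path_cong\<close>; \<open>contour_map\<close> (from F followed by the unit of the
  target) and \<open>contour_counit\<close> (from the identity of the spliced operad) inherit it by
  agreeing with an extension path by path. Partial composition of spliced arrows is needed in two
  shapes. Glued blocks suit the operad axioms, where a case distinction by position would multiply,
  and a constant is no special case for them. The entry-by-entry description suits the contour
  relations, since its branches are those of \<open>contour_rhs\<close>. It enters through
  \<open>splice_comp_nth_path\<close>, which serves in both directions: for sequences of generators
  it shows that the unit preserves partial composition, and for the image of a functor into spliced
  arrows it shows that the extension respects the relations.\<close>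

primrec arrow_path :: "('o, 'a) cat_data \<Rightarrow> 'o \<Rightarrow> 'a list \<Rightarrow> 'o \<Rightarrow> bool" where
  "arrow_path \<C> x [] y \<longleftrightarrow> x \<in> Obj \<C> \<and> x = y"
| "arrow_path \<C> x (f # fs) y \<longleftrightarrow> f \<in> Arr \<C> \<and> Dom \<C> f = x \<and> arrow_path \<C> (Cod \<C> f) fs y"

text \<open>A left fold, to agree literally with the fold in \<open>contour_counit\<close>. The
  initial identity gives the empty path a value, which is why the starting object is an
  argument.\<close>

definition path_comp :: "('o, 'a) cat_data \<Rightarrow> 'o \<Rightarrow> 'a list \<Rightarrow> 'a" where
  "path_comp \<C> x fs = foldl (Comp \<C>) (Idn \<C> x) fs"

lemma path_comp_Nil: "path_comp \<C> x [] = Idn \<C> x"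
  by (simp add: path_comp_def)

context category
begin

text \<open>The initial arrow is arbitrary because the accumulator changes along the fold. The types
  of the composite are proved together with the equation, since associativity in the inductive step
  needs them.\<close>

lemma foldl_Comp:
  assumes "arrow_path \<C> x fs y" "f \<in> Arr \<C>" "Cod \<C> f = x"
  shows "foldl (Comp \<C>) f fs = Comp \<C> f (path_comp \<C> x fs) \<and> path_comp \<C> x fs \<in> Arr \<C> \<and>
    Dom \<C> (path_comp \<C> x fs) = x \<and> Cod \<C> (path_comp \<C> x fs) = y"
  using assms
proof (induction fs arbitrary: x f)
  case Nil
  then show ?case
    by (auto simp: path_comp_def Idn_Arr Dom_Idn Cod_Idn Idn_right)
next
  case (Cons g fs)
  then have g: "g \<in> Arr \<C>" "Dom \<C> g = x" "arrow_path \<C> (Cod \<C> g) fs y"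
    by auto
  \<comment> \<open>The leading identity is absorbed by \<open>g\<close>, so the fold over
    \<open>g # fs\<close> is the fold over \<open>fs\<close> with accumulator \<open>g\<close>, to
    which the induction hypothesis applies.\<close>
  have pc: "path_comp \<C> x (g # fs) = Comp \<C> g (path_comp \<C> (Cod \<C> g) fs)"
    using Cons.IH[of "Cod \<C> g" g] g Idn_left[of g] by (simp add: path_comp_def)
  show ?case
    using Cons.IH[of "Cod \<C> g" g] Cons.IH[of "Cod \<C> g" "Comp \<C> f g"] g Cons.prems pc
    by (auto simp: Comp_Arr Dom_Comp Cod_Comp Comp_assoc)
qed

lemma arrow_path_Obj: "arrow_path \<C> x fs y \<Longrightarrow> x \<in> Obj \<C> \<and> y \<in> Obj \<C>"
  by (induction fs arbitrary: x) (auto simp: Dom_Obj)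

lemma path_comp_arrow:
  assumes "arrow_path \<C> x fs y"
  shows "path_comp \<C> x fs \<in> Arr \<C>" "Dom \<C> (path_comp \<C> x fs) = x" "Cod \<C> (path_comp \<C> x fs) = y"
  using foldl_Comp[OF assms, of "Idn \<C> x"] arrow_path_Obj[OF assms] by (simp_all add: Idn_Arr Cod_Idn)

lemma path_comp_append:
  assumes "arrow_path \<C> x fs y" "arrow_path \<C> y gs z"
  shows "path_comp \<C> x (fs @ gs) = Comp \<C> (path_comp \<C> x fs) (path_comp \<C> y gs)"
  using foldl_Comp[OF assms(2), of "path_comp \<C> x fs"] path_comp_arrow[OF assms(1)]
  by (simp add: path_comp_def)

lemma path_comp_single: "f \<in> Arr \<C> \<Longrightarrow> Dom \<C> f = x \<Longrightarrow> path_comp \<C> x [f] = f"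
  by (auto simp: path_comp_def Idn_left)

end

lemma (in category_functor) arrow_path_map:
  "arrow_path \<C> x fs y \<Longrightarrow> arrow_path \<D> (on_obj F x) (map (on_arr F) fs) (on_obj F y)"
  using on_obj on_arr
  by (induction fs arbitrary: x) (auto simp: map_Dom map_Cod PiE_mem)

text \<open>The induction removes arrows at the front although the fold nests to the left;
  \<open>path_comp_append\<close> with a one-arrow prefix reconciles the two.\<close>

lemma (in category_functor) map_path_comp:
  assumes "arrow_path \<C> x fs y"
  shows "on_arr F (path_comp \<C> x fs) = path_comp \<D> (on_obj F x) (map (on_arr F) fs)"
  using assms
proof (induction fs arbitrary: x)
  case Nil
  then show ?case by (auto simp: path_comp_def map_Idn)
next
  case (Cons g fs)
  then have g: "g \<in> Arr \<C>" "Dom \<C> g = x" "arrow_path \<C> (Cod \<C> g) fs y"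
    by auto
  have Fg: "on_arr F g \<in> Arr \<D>" "on_obj F (Cod \<C> g) \<in> Obj \<D>"
    using g on_arr on_obj by (auto simp: source.Cod_Obj PiE_mem)
  have "path_comp \<C> x (g # fs) = Comp \<C> g (path_comp \<C> (Cod \<C> g) fs)"
    using source.path_comp_append[of x "[g]" "Cod \<C> g" fs y] g
    by (simp add: source.path_comp_single source.Cod_Obj)
  moreover have "path_comp \<D> (on_obj F x) (map (on_arr F) (g # fs)) =
      Comp \<D> (on_arr F g) (path_comp \<D> (on_obj F (Cod \<C> g)) (map (on_arr F) fs))"
    using target.path_comp_append[of "on_obj F x" "[on_arr F g]" "on_obj F (Cod \<C> g)"
        "map (on_arr F) fs" "on_obj F y"] g Fg arrow_path_map[OF g(3)]
    by (auto simp: target.path_comp_single map_Dom map_Cod)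
  ultimately show ?case
    using Cons.IH[OF g(3)] g source.path_comp_arrow[OF g(3)] by (simp add: map_Comp)
qed

section \<open>Spliced arrows\<close>

definition glue :: "('o, 'a) cat_data \<Rightarrow> 'a list \<Rightarrow> 'a list \<Rightarrow> 'a list" where
  "glue \<C> p q = butlast p @ [Comp \<C> (last p) (hd q)] @ tl q"

lemma spliced_simps:
  "Col (spliced \<C>) = Obj \<C> \<times> Obj \<C>"
  "w \<in> Ops (spliced \<C>) \<longleftrightarrow> w \<noteq> [] \<and> set w \<subseteq> Arr \<C>"
  "Out (spliced \<C>) w = (Dom \<C> (hd w), Cod \<C> (last w))"
  "Oid (spliced \<C>) (A, B) = [Idn \<C> A, Idn \<C> B]"
  "Pcomp (spliced \<C>) = splice_comp \<C>"
  by (simp_all add: spliced_def)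

lemma arity_spliced: "arity (spliced \<C>) w = length w - 1"
  by (simp add: arity_def spliced_def)

lemma Ins_spliced_nth:
  "Suc i < length w \<Longrightarrow> Ins (spliced \<C>) w ! i = (Cod \<C> (w ! i), Dom \<C> (w ! Suc i))"
  by (simp add: spliced_def nth_butlast nth_tl)

lemma length_Ins_spliced: "length (Ins (spliced \<C>) w) = length w - 1"
  by (simp add: spliced_def)

text \<open>Concatenation opens exactly one new gap, at the seam; gluing closes it.\<close>

lemma Ins_spliced_append:
  assumes "p \<noteq> []" "q \<noteq> []"
  shows "Ins (spliced \<C>) (p @ q) =
    Ins (spliced \<C>) p @ (Cod \<C> (last p), Dom \<C> (hd q)) # Ins (spliced \<C>) q"
  using assms
proof (induction p)
  case (Cons a p)
  then show ?case
    by (cases p; cases q) (auto simp: spliced_def)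
qed simp

text \<open>A gap sees only the codomain on its left and the domain on its right. The composite at
  the seam has the domain of one factor and the codomain of the other, so no neighboring gap changes
  color.\<close>

lemma Ins_spliced_glue:
  assumes "p \<noteq> []" "q \<noteq> []"
    and "Dom \<C> (Comp \<C> (last p) (hd q)) = Dom \<C> (last p)"
    and "Cod \<C> (Comp \<C> (last p) (hd q)) = Cod \<C> (hd q)"
  shows "Ins (spliced \<C>) (glue \<C> p q) = Ins (spliced \<C>) p @ Ins (spliced \<C>) q"
proof -
  obtain p' a b q' where pq: "p = p' @ [a]" "q = b # q'"
    using assms by (metis append_butlast_last_id list.exhaust)
  show ?thesis
    using assms(3,4) Ins_spliced_append[of p' "[a]" \<C>] Ins_spliced_append[of "[b]" q' \<C>]
      Ins_spliced_append[of p' "[Comp \<C> a b]" \<C>] Ins_spliced_append[of "[Comp \<C> a b]" q' \<C>]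
      Ins_spliced_append[of "p' @ [Comp \<C> a b]" "q'" \<C>]
    by (cases "p' = []"; cases "q' = []") (auto simp: glue_def pq spliced_def)
qed

text \<open>The case split of \<open>splice_comp\<close> disappears: if \<open>v\<close> is a single
  arrow, the first gluing turns it into the composite that the second one extends, with the same
  bracketing.\<close>

lemma splice_comp_eq_glue:
  assumes "v \<noteq> []" "Suc i < length w"
  shows "splice_comp \<C> w i v = glue \<C> (glue \<C> (take (Suc i) w) v) (drop (Suc i) w)"
proof -
  have w: "take (Suc i) w = take i w @ [w ! i]" "drop (Suc i) w = w ! Suc i # drop (i + 2) w"
    using assms by (simp_all add: take_Suc_conv_app_nth Cons_nth_drop_Suc)
  show ?thesis
  proof (cases "tl v")
    case Nil
    then show ?thesis
      using assms(1) by (cases v) (auto simp: splice_comp_def glue_def w)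
  next
    case (Cons a u)
    then obtain c where "v = c # a # u"
      using assms(1) by (cases v) auto
    then show ?thesis
      by (auto simp: splice_comp_def glue_def w butlast_append)
  qed
qed

lemma glue_nonempty [simp]: "glue \<C> p q \<noteq> []"
  by (simp add: glue_def)

lemma length_glue: "p \<noteq> [] \<Longrightarrow> q \<noteq> [] \<Longrightarrow> length (glue \<C> p q) = length p + length q - 1"
  by (cases p; cases q) (auto simp: glue_def)

text \<open>Gluing is local: a block away from the seam can be moved outside. With its mirror image
  below, this locates gaps that an insertion leaves open.\<close>

lemma glue_append_left: "q \<noteq> [] \<Longrightarrow> glue \<C> (p @ q) r = p @ glue \<C> q r"
  by (simp add: glue_def butlast_append)

lemma glue_append_right: "q \<noteq> [] \<Longrightarrow> glue \<C> p (q @ r) = glue \<C> p q @ r"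
  by (simp add: glue_def)

lemma length_splice_comp:
  assumes "v \<noteq> []" "Suc i < length w"
  shows "length (splice_comp \<C> w i v) = length w + length v - 2"
proof -
  have "take (Suc i) w \<noteq> []" "drop (Suc i) w \<noteq> []" using assms by auto
  then show ?thesis
    using assms by (simp add: splice_comp_eq_glue length_glue)
qed

text \<open>The branches copy those of \<open>contour_rhs\<close>, with \<open>m\<close> the arity
  of \<open>v\<close>, so that the two tables can be compared case by case.\<close>

lemma splice_comp_nth:
  assumes "v \<noteq> []" "Suc i < length w" "j < length w + length v - 2" "m = length v - 1"
  shows "splice_comp \<C> w i v ! j =
    (if m > 0 then
       (if j < i then w ! j
        else if j = i then Comp \<C> (w ! i) (v ! 0)
        else if j < i + m then v ! (j - i)
        else if j = i + m then Comp \<C> (v ! m) (w ! (i + 1))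
        else w ! (j - m + 1))
     else
       (if j < i then w ! j
        else if j = i then Comp \<C> (Comp \<C> (w ! i) (v ! 0)) (w ! (i + 1))
        else w ! (j + 1)))"
proof (cases "m > 0")
  case True
  then obtain c a u where v: "v = c # a # u"
    using assms(1,4) by (cases v; cases "tl v") auto
  show ?thesis
    using assms True
    by (auto simp: splice_comp_def v nth_append nth_Cons' nth_butlast last_conv_nth min_def
        intro!: arg_cong[where f = "nth _"])
next
  case False
  then obtain c where v: "v = [c]"
    using assms(1,4) by (cases v) auto
  show ?thesis
    using assms by (auto simp: splice_comp_def v nth_append nth_Cons' min_def)
qed

section \<open>The operad axioms for spliced arrows\<close>

context category
begin

lemma Arr_glue:
  assumes "p \<noteq> []" "q \<noteq> []" "set p \<subseteq> Arr \<C>" "set q \<subseteq> Arr \<C>" "Cod \<C> (last p) = Dom \<C> (hd q)"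
  shows "set (glue \<C> p q) \<subseteq> Arr \<C>"
    and "Dom \<C> (hd (glue \<C> p q)) = Dom \<C> (hd p)"
    and "Cod \<C> (last (glue \<C> p q)) = Cod \<C> (last q)"
    and "Ins (spliced \<C>) (glue \<C> p q) = Ins (spliced \<C>) p @ Ins (spliced \<C>) q"
proof -
  obtain p' a b q' where pq: "p = p' @ [a]" "q = b # q'"
    using assms by (metis append_butlast_last_id list.exhaust)
  show "set (glue \<C> p q) \<subseteq> Arr \<C>" "Dom \<C> (hd (glue \<C> p q)) = Dom \<C> (hd p)"
    "Cod \<C> (last (glue \<C> p q)) = Cod \<C> (last q)"
    using assms(3-5) unfolding pq
    by (cases p'; auto simp: glue_def Comp_Arr Dom_Comp Cod_Comp)+
  show "Ins (spliced \<C>) (glue \<C> p q) = Ins (spliced \<C>) p @ Ins (spliced \<C>) q"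
    using assms by (intro Ins_spliced_glue) (auto simp: pq Dom_Comp Cod_Comp)
qed

text \<open>If \<open>q\<close> has at least two arrows, the two seams involve different arrows and
  both sides compute to the same list. Associativity of composition enters only when
  \<open>q\<close> is a single arrow that belongs to both seams.\<close>

lemma glue_assoc:
  assumes "p \<noteq> []" "q \<noteq> []" "r \<noteq> []" "set p \<subseteq> Arr \<C>" "set q \<subseteq> Arr \<C>" "set r \<subseteq> Arr \<C>"
    "Cod \<C> (last p) = Dom \<C> (hd q)" "Cod \<C> (last q) = Dom \<C> (hd r)"
  shows "glue \<C> (glue \<C> p q) r = glue \<C> p (glue \<C> q r)"
proof -
  obtain p' a b r' where pr: "p = p' @ [a]" "r = b # r'"
    using assms by (metis append_butlast_last_id list.exhaust)
  obtain c q' where q: "q = c # q'" using assms by (cases q) auto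
  show ?thesis
    using assms by (cases "q' = []") (auto simp: glue_def pr q butlast_append Comp_assoc)
qed

text \<open>Equality of colors at the gap is a pair of equations, one for each seam of the
  gluing.\<close>

lemma spliced_composableD:
  assumes "composable (spliced \<C>) w i v"
  obtains p q where "w = p @ q" "length p = Suc i" "p \<noteq> []" "q \<noteq> []" "v \<noteq> []"
    "set p \<subseteq> Arr \<C>" "set q \<subseteq> Arr \<C>" "set v \<subseteq> Arr \<C>"
    "Cod \<C> (last p) = Dom \<C> (hd v)" "Cod \<C> (last v) = Dom \<C> (hd q)"
    "splice_comp \<C> w i v = glue \<C> (glue \<C> p v) q"
proof -
  have w: "w \<noteq> []" "set w \<subseteq> Arr \<C>" "v \<noteq> []" "set v \<subseteq> Arr \<C>" "Suc i < length w"
    "(Dom \<C> (hd v), Cod \<C> (last v)) = (Cod \<C> (w ! i), Dom \<C> (w ! Suc i))"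
    using assms by (auto simp: composable_def spliced_simps arity_spliced Ins_spliced_nth)
  show ?thesis
  proof (rule that[of "take (Suc i) w" "drop (Suc i) w"])
    show "Cod \<C> (last (take (Suc i) w)) = Dom \<C> (hd v)"
      using w by (simp add: take_Suc_conv_app_nth)
    show "Cod \<C> (last v) = Dom \<C> (hd (drop (Suc i) w))"
      using w by (simp add: hd_drop_conv_nth)
  qed (use w in \<open>auto dest: in_set_takeD in_set_dropD simp: splice_comp_eq_glue\<close>)
qed

lemma spliced_operad: "operad (spliced \<C>)"
proof
  fix f assume "f \<in> Ops (spliced \<C>)"
  then have f: "f \<noteq> []" "set f \<subseteq> Arr \<C>" by (simp_all add: spliced_simps)
  show "set (Ins (spliced \<C>) f) \<subseteq> Col (spliced \<C>)"
  proof
    fix x assume "x \<in> set (Ins (spliced \<C>) f)"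
    then obtain i where "i < length f - 1" "x = Ins (spliced \<C>) f ! i"
      by (auto simp: in_set_conv_nth length_Ins_spliced)
    then have "Suc i < length f" "x = (Cod \<C> (f ! i), Dom \<C> (f ! Suc i))"
      by (simp_all add: Ins_spliced_nth)
    then show "x \<in> Col (spliced \<C>)"
      using f by (auto simp: spliced_simps intro!: Cod_Obj Dom_Obj)
  qed
  show "Out (spliced \<C>) f \<in> Col (spliced \<C>)"
    using f by (auto simp: spliced_simps intro!: Cod_Obj Dom_Obj)
  \<comment> \<open>The two entries of the identity operation meet only the first and the last arrow
    of \<open>f\<close>, where the unit laws absorb them.\<close>
  have "splice_comp \<C> [Idn \<C> (Dom \<C> (hd f)), Idn \<C> (Cod \<C> (last f))] 0 f =
      glue \<C> (glue \<C> [Idn \<C> (Dom \<C> (hd f))] f) [Idn \<C> (Cod \<C> (last f))]"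
    using f by (simp add: splice_comp_eq_glue)
  also have "glue \<C> [Idn \<C> (Dom \<C> (hd f))] f = f"
    using f by (cases f) (auto simp: glue_def Idn_left)
  also have "glue \<C> f [Idn \<C> (Cod \<C> (last f))] = f"
    using f by (cases f rule: rev_cases) (auto simp: glue_def Idn_right)
  finally show "Pcomp (spliced \<C>) (Oid (spliced \<C>) (Out (spliced \<C>) f)) 0 f = f"
    by (simp add: spliced_simps)
  fix i assume "i < arity (spliced \<C>) f"
  then have i: "Suc i < length f" by (simp add: arity_spliced)
  then have f': "take (Suc i) f = take i f @ [f ! i]" "drop (Suc i) f = f ! Suc i # drop (i + 2) f"
    "f = take i f @ [f ! i, f ! Suc i] @ drop (i + 2) f"
    by (simp_all add: take_Suc_conv_app_nth Cons_nth_drop_Suc id_take_nth_drop)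
  have "f ! i \<in> Arr \<C>" "f ! Suc i \<in> Arr \<C>" using f i by auto
  then show "Pcomp (spliced \<C>) f i (Oid (spliced \<C>) (Ins (spliced \<C>) f ! i)) = f"
    using f i f'
    by (simp add: spliced_simps Ins_spliced_nth splice_comp_eq_glue glue_def butlast_append
        Idn_left Idn_right)
next
  fix R assume "R \<in> Col (spliced \<C>)"
  then obtain A B where R: "R = (A, B)" "A \<in> Obj \<C>" "B \<in> Obj \<C>" by (auto simp: spliced_simps)
  then show "Oid (spliced \<C>) R \<in> Ops (spliced \<C>)" "Out (spliced \<C>) (Oid (spliced \<C>) R) = R"
    by (simp_all add: spliced_simps Idn_Arr Dom_Idn Cod_Idn)
  show "Ins (spliced \<C>) (Oid (spliced \<C>) R) = [R]"
    using R by (simp add: spliced_def Idn_Arr Dom_Idn Cod_Idn)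
next
  fix f g i assume c: "composable (spliced \<C>) f i g"
  obtain p q where pq: "f = p @ q" "length p = Suc i" "p \<noteq> []" "q \<noteq> []" "g \<noteq> []"
    "set p \<subseteq> Arr \<C>" "set q \<subseteq> Arr \<C>" "set g \<subseteq> Arr \<C>"
    "Cod \<C> (last p) = Dom \<C> (hd g)" "Cod \<C> (last g) = Dom \<C> (hd q)"
    "splice_comp \<C> f i g = glue \<C> (glue \<C> p g) q"
    using spliced_composableD[OF c] by blast
  note g = Arr_glue[of p g] Arr_glue[of "glue \<C> p g" q]
  show "Pcomp (spliced \<C>) f i g \<in> Ops (spliced \<C>)"
    using pq g by (simp add: spliced_simps)
  show "Out (spliced \<C>) (Pcomp (spliced \<C>) f i g) = Out (spliced \<C>) f"
    using pq g by (simp add: spliced_simps)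
  \<comment> \<open>The gap that \<open>g\<close> fills separates the gaps of \<open>p\<close> from
    those of \<open>q\<close>; gluing keeps the gaps of \<open>p\<close>, \<open>g\<close> and
    \<open>q\<close> in this order and adds none.\<close>
  have "Ins (spliced \<C>) f =
      Ins (spliced \<C>) p @ (Cod \<C> (last p), Dom \<C> (hd q)) # Ins (spliced \<C>) q"
    using pq by (simp add: Ins_spliced_append)
  moreover have "length (Ins (spliced \<C>) p) = i"
    using pq by (simp add: length_Ins_spliced)
  ultimately show "Ins (spliced \<C>) (Pcomp (spliced \<C>) f i g) =
      take i (Ins (spliced \<C>) f) @ Ins (spliced \<C>) g @ drop (Suc i) (Ins (spliced \<C>) f)"
    using pq g by (simp add: spliced_simps)
next
  fix f g h i j
  assume c: "composable (spliced \<C>) f i g" "composable (spliced \<C>) g j h"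
  obtain p q where pq: "f = p @ q" "length p = Suc i" "p \<noteq> []" "q \<noteq> []" "g \<noteq> []"
    "set p \<subseteq> Arr \<C>" "set q \<subseteq> Arr \<C>" "set g \<subseteq> Arr \<C>"
    "Cod \<C> (last p) = Dom \<C> (hd g)" "Cod \<C> (last g) = Dom \<C> (hd q)"
    "splice_comp \<C> f i g = glue \<C> (glue \<C> p g) q"
    using spliced_composableD[OF c(1)] by blast
  obtain r s where rs: "g = r @ s" "length r = Suc j" "r \<noteq> []" "s \<noteq> []" "h \<noteq> []"
    "set r \<subseteq> Arr \<C>" "set s \<subseteq> Arr \<C>" "set h \<subseteq> Arr \<C>"
    "Cod \<C> (last r) = Dom \<C> (hd h)" "Cod \<C> (last h) = Dom \<C> (hd s)"
    "splice_comp \<C> g j h = glue \<C> (glue \<C> r h) s"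
    using spliced_composableD[OF c(2)] by blast
  have ends: "Cod \<C> (last p) = Dom \<C> (hd r)" "Cod \<C> (last s) = Dom \<C> (hd q)"
    using pq rs by simp_all
  \<comment> \<open>The gap of \<open>g\<close> between \<open>r\<close> and \<open>s\<close> stays
    open when \<open>g\<close> is inserted. It now lies between two glued blocks, and the length of
    the first block identifies it as gap \<open>i + j\<close>.\<close>
  have fg: "splice_comp \<C> f i g = glue \<C> p r @ glue \<C> s q"
    using pq rs by (simp add: glue_append_left glue_append_right)
  have len: "length (glue \<C> p r) = Suc (i + j)"
    using pq rs by (simp add: length_glue)
  have "splice_comp \<C> (splice_comp \<C> f i g) (i + j) h =
      glue \<C> (glue \<C> (glue \<C> p r) h) (glue \<C> s q)"
    unfolding fg using rs(5) len by (simp add: splice_comp_eq_glue)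
  also have "\<dots> = glue \<C> (glue \<C> p (glue \<C> (glue \<C> r h) s)) q"
    using pq(2-8) rs(2-10) ends by (simp add: glue_assoc Arr_glue)
  also have "\<dots> = splice_comp \<C> f i (splice_comp \<C> g j h)"
    unfolding rs(11) using pq(1-5) by (simp add: splice_comp_eq_glue)
  finally show "Pcomp (spliced \<C>) (Pcomp (spliced \<C>) f i g) (i + j) h =
      Pcomp (spliced \<C>) f i (Pcomp (spliced \<C>) g j h)"
    by (simp add: spliced_simps)
next
  fix f g h i j
  assume c: "composable (spliced \<C>) f i g" "composable (spliced \<C>) f j h" and ij: "i < j"
  obtain p q' where pq: "f = p @ q'" "length p = Suc i" "p \<noteq> []" "q' \<noteq> []" "g \<noteq> []"
    "set p \<subseteq> Arr \<C>" "set q' \<subseteq> Arr \<C>" "set g \<subseteq> Arr \<C>"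
    "Cod \<C> (last p) = Dom \<C> (hd g)" "Cod \<C> (last g) = Dom \<C> (hd q')"
    "splice_comp \<C> f i g = glue \<C> (glue \<C> p g) q'"
    using spliced_composableD[OF c(1)] by blast
  obtain r' s where rs: "f = r' @ s" "length r' = Suc j" "r' \<noteq> []" "s \<noteq> []" "h \<noteq> []"
    "set r' \<subseteq> Arr \<C>" "set s \<subseteq> Arr \<C>" "set h \<subseteq> Arr \<C>"
    "Cod \<C> (last r') = Dom \<C> (hd h)" "Cod \<C> (last h) = Dom \<C> (hd s)"
    "splice_comp \<C> f j h = glue \<C> (glue \<C> r' h) s"
    using spliced_composableD[OF c(2)] by blast
  \<comment> \<open>Since \<open>i < j\<close>, the two splittings of \<open>f\<close> refine to
    \<open>p @ q @ s\<close>, with gap \<open>i\<close> before \<open>q\<close> and gap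
    \<open>j\<close> after it.\<close>
  obtain q where q: "q' = q @ s" "r' = p @ q"
    using pq(1,2) rs(1,2) ij by (auto simp: append_eq_append_conv2)
  then have q0: "q \<noteq> []" "set q \<subseteq> Arr \<C>" "Cod \<C> (last g) = Dom \<C> (hd q)"
    "Cod \<C> (last q) = Dom \<C> (hd h)" "Suc i + length q = Suc j"
    using pq rs ij by auto
  have fg: "splice_comp \<C> f i g = glue \<C> (glue \<C> p g) q @ s"
    using pq q q0 by (simp add: glue_append_right)
  have fh: "splice_comp \<C> f j h = p @ glue \<C> (glue \<C> q h) s"
    using rs q q0 by (simp add: glue_append_left)
  \<comment> \<open>Filling gap \<open>i\<close> replaces one gap by as many as \<open>g\<close>
    has, which shifts gap \<open>j\<close>. For a constant \<open>g\<close> the index drops to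
    \<open>j - 1\<close>, and \<open>i < j\<close> keeps the subtraction exact.\<close>
  have len: "length (glue \<C> (glue \<C> p g) q) = Suc (j + (length g - 1) - 1)"
    using pq q0 ij by (cases g) (simp_all add: length_glue)
  have "splice_comp \<C> (splice_comp \<C> f i g) (j + arity (spliced \<C>) g - 1) h =
      glue \<C> (glue \<C> (glue \<C> (glue \<C> p g) q) h) s"
    unfolding fg using rs(4,5) len pq(5) by (simp add: splice_comp_eq_glue arity_spliced)
  also have "\<dots> = glue \<C> (glue \<C> p g) (glue \<C> (glue \<C> q h) s)"
    using pq(2-10) rs(4-10) q0 by (simp add: glue_assoc Arr_glue)
  also have "\<dots> = splice_comp \<C> (splice_comp \<C> f j h) i g"
    unfolding fh using pq(2,5) by (simp add: splice_comp_eq_glue)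
  finally show "Pcomp (spliced \<C>) (Pcomp (spliced \<C>) f i g) (j + arity (spliced \<C>) g - 1) h =
      Pcomp (spliced \<C>) (Pcomp (spliced \<C>) f j h) i g"
    by (simp add: spliced_simps)
qed

end

section \<open>Functoriality of spliced arrows\<close>

lemma (in category_functor) splice_map_functor:
  "operad_functor (spliced \<C>) (spliced \<D>) (splice_map \<C> F)"
proof -
  interpret s: operad "spliced \<C>" by (rule source.spliced_operad)
  interpret t: operad "spliced \<D>" by (rule target.spliced_operad)
  have arr: "f \<in> Arr \<C> \<Longrightarrow> on_arr F f \<in> Arr \<D>" and obj: "A \<in> Obj \<C> \<Longrightarrow> on_obj F A \<in> Obj \<D>" for f A
    using on_arr on_obj by auto
  have nth: "w \<in> Ops (spliced \<C>) \<Longrightarrow> i < length w \<Longrightarrow> w ! i \<in> Arr \<C>" for w i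
    by (auto simp: spliced_simps)
  show ?thesis
  proof
    show "on_col (splice_map \<C> F) \<in> Col (spliced \<C>) \<rightarrow>\<^sub>E Col (spliced \<D>)"
      by (auto simp: splice_map_def spliced_simps obj)
    show "on_ops (splice_map \<C> F) \<in> Ops (spliced \<C>) \<rightarrow>\<^sub>E Ops (spliced \<D>)"
      by (auto simp: splice_map_def spliced_simps subset_iff intro!: arr)
    show "on_ops (splice_map \<C> F) (Oid (spliced \<C>) R) =
        Oid (spliced \<D>) (on_col (splice_map \<C> F) R)" if "R \<in> Col (spliced \<C>)" for R
      using that s.Oid_Ops[OF that] by (auto simp: splice_map_def spliced_simps map_Idn)
    fix f assume f: "f \<in> Ops (spliced \<C>)"
    have "set (Ins (spliced \<C>) f) \<subseteq> Col (spliced \<C>)" by (rule s.Ins_Col[OF f])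
    then have "map (on_col (splice_map \<C> F)) (Ins (spliced \<C>) f) =
      map (\<lambda>(A, B). (on_obj F A, on_obj F B)) (Ins (spliced \<C>) f)"
      by (auto simp: splice_map_def)
    also have "\<dots> = Ins (spliced \<D>) (map (on_arr F) f)"
      by (rule nth_equalityI)
        (auto simp: length_Ins_spliced Ins_spliced_nth nth[OF f] map_Dom map_Cod)
    finally show "Ins (spliced \<D>) (on_ops (splice_map \<C> F) f) =
        map (on_col (splice_map \<C> F)) (Ins (spliced \<C>) f)"
      using f by (simp add: splice_map_def)
    show "Out (spliced \<D>) (on_ops (splice_map \<C> F) f) =
        on_col (splice_map \<C> F) (Out (spliced \<C>) f)"
      using f s.Out_Col[OF f]
      by (auto simp: splice_map_def spliced_simps map_Dom map_Cod hd_map last_map subset_iff)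
  next
    fix f g i assume c: "composable (spliced \<C>) f i g"
    obtain p q where pq: "f = p @ q" "length p = Suc i" "p \<noteq> []" "q \<noteq> []" "g \<noteq> []"
      "set p \<subseteq> Arr \<C>" "set q \<subseteq> Arr \<C>" "set g \<subseteq> Arr \<C>"
      "Cod \<C> (last p) = Dom \<C> (hd g)" "Cod \<C> (last g) = Dom \<C> (hd q)"
      "splice_comp \<C> f i g = glue \<C> (glue \<C> p g) q"
      using source.spliced_composableD[OF c] by blast
    \<comment> \<open>Arrows are composed only at seams, so this is where preservation of
      composition by \<open>F\<close> enters.\<close>
    have map_glue: "map (on_arr F) (glue \<C> r s) = glue \<D> (map (on_arr F) r) (map (on_arr F) s)"
      if "r \<noteq> []" "s \<noteq> []" "set r \<subseteq> Arr \<C>" "set s \<subseteq> Arr \<C>" "Cod \<C> (last r) = Dom \<C> (hd s)" for r s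
      using that
      by (auto simp: glue_def map_butlast map_tl last_map hd_map intro!: map_Comp)
    have "map (on_arr F) (splice_comp \<C> f i g) =
        glue \<D> (glue \<D> (map (on_arr F) p) (map (on_arr F) g)) (map (on_arr F) q)"
      using pq by (simp add: map_glue source.Arr_glue)
    also have "\<dots> = splice_comp \<D> (map (on_arr F) f) i (map (on_arr F) g)"
      using pq by (simp add: splice_comp_eq_glue)
    finally show "on_ops (splice_map \<C> F) (Pcomp (spliced \<C>) f i g) =
        Pcomp (spliced \<D>) (on_ops (splice_map \<C> F) f) i (on_ops (splice_map \<C> F) g)"
      using s.Pcomp_Ops[OF c] c
      by (simp add: splice_map_def spliced_simps(5) composable_def)
  qed
qed

lemma splice_map_id: "splice_map \<C> (id_functor \<C>) = id_operad_functor (spliced \<C>)"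
  by (auto simp: splice_map_def id_functor_def id_operad_functor_def spliced_simps fun_eq_iff
      restrict_def intro!: map_idI)

lemma splice_map_comp:
  assumes "category_functor \<C> \<D> F" "category_functor \<D> \<E> G"
  shows "splice_map \<C> (comp_functor \<C> F G) =
    comp_operad_functor (spliced \<C>) (splice_map \<C> F) (splice_map \<D> G)"
proof -
  interpret F: category_functor \<C> \<D> F by fact
  have "A \<in> Obj \<C> \<Longrightarrow> on_obj F A \<in> Obj \<D>" "f \<in> Arr \<C> \<Longrightarrow> on_arr F f \<in> Arr \<D>" for A f
    using F.on_obj F.on_arr by auto
  then show ?thesis
    by (auto simp: splice_map_def comp_functor_def comp_operad_functor_def spliced_simps fun_eq_iff
        restrict_def compose_def subset_iff)
qed

text \<open>The bridge between splicing and the contour relations: reading each pair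
  \<open>(u, k)\<close> as the entry \<open>u ! k\<close> turns the right-hand side of a relation
  into the factors of an entry of the splice.\<close>

lemma (in category) splice_comp_nth_path:
  assumes c: "composable (spliced \<C>) w i v" and j: "j < length (splice_comp \<C> w i v)"
    and path: "arrow_path \<C> x (map (\<lambda>(u, k). u ! k) (contour_rhs (spliced \<C>) w i v j)) y"
  shows "splice_comp \<C> w i v ! j =
    path_comp \<C> x (map (\<lambda>(u, k). u ! k) (contour_rhs (spliced \<C>) w i v j))"
proof -
  have *: "v \<noteq> []" "Suc i < length w"
    using c by (auto simp: composable_def spliced_simps arity_spliced)
  have j': "j < length w + length v - 2"
    using j * by (simp add: length_splice_comp)
  define m where "m = length v - 1"
  note nth = splice_comp_nth[OF * j' m_def, of \<C>]
  \<comment> \<open>A right-hand side has at most three factors, and the left fold brackets them as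
    \<open>splice_comp\<close> does. Only the leading identity has to go, for which the type of the
    first factor suffices.\<close>
  have pc: "path_comp \<C> x [a] = a" "path_comp \<C> x [a, b] = Comp \<C> a b"
    "path_comp \<C> x [a, b, d] = Comp \<C> (Comp \<C> a b) d" if "a \<in> Arr \<C>" "Dom \<C> a = x" for a b d
    using that by (auto simp: path_comp_def Idn_left)
  show ?thesis
    using path unfolding nth contour_rhs_def Let_def arity_spliced m_def[symmetric]
    by (cases "m = 0"; cases "j < i"; cases "j = i"; cases "j < i + m"; cases "j = i + m"; simp add: pc)
qed

section \<open>The contour category\<close>

lemma class_val_eq:
  assumes "p \<in> X" "\<And>q. q \<in> X \<Longrightarrow> h q = h p"
  shows "class_val h X = h p"
proof -
  have "h ` X = {h p}" using assms(1) by (auto dest: assms(2))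
  then show ?thesis by (simp add: class_val_def)
qed

lemma contour_simps:
  "Obj (contour \<O>) = contour_objs \<O>"
  "Arr (contour \<O>) = contour_paths \<O> // contour_cong \<O>"
  "Idn (contour \<O>) x = contour_class \<O> (x, [], x)"
  by (simp_all add: contour_def)

text \<open>The branch taken depends on \<open>g\<close> only through its arity, so relabeling
  operations commutes with forming the right-hand side.\<close>

lemma contour_rhs_map:
  "arity \<P> (h g) = arity \<O> g \<Longrightarrow>
    contour_rhs \<P> (h f) i (h g) j = map (\<lambda>(f, k). (h f, k)) (contour_rhs \<O> f i g j)"
  by (simp add: contour_rhs_def Let_def)

lemma is_path_append:
  "is_path \<O> x es y \<Longrightarrow> is_path \<O> y ds z \<Longrightarrow> is_path \<O> x (es @ ds) z"
  by (induction es arbitrary: x) auto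

lemma set_is_path: "is_path \<O> x es y \<Longrightarrow> set es \<subseteq> contour_gens \<O>"
  by (induction es arbitrary: x) auto

section \<open>Typing of paths and of the relations\<close>

context operad
begin

lemma arity_Oid: "R \<in> Col \<O> \<Longrightarrow> arity \<O> (Oid \<O> R) = 1"
  by (simp add: arity_def Ins_Oid)

lemma arity_Pcomp: "composable \<O> f i g \<Longrightarrow> arity \<O> (Pcomp \<O> f i g) = arity \<O> f + arity \<O> g - 1"
  by (auto simp: arity_def Ins_Pcomp composable_def)

lemma Ins_nth_Col: "f \<in> Ops \<O> \<Longrightarrow> i < arity \<O> f \<Longrightarrow> Ins \<O> f ! i \<in> Col \<O>"
  using Ins_Col[of f] by (auto simp: arity_def)

lemma gen_dom_cod_objs:
  "e \<in> contour_gens \<O> \<Longrightarrow> gen_dom \<O> e \<in> contour_objs \<O> \<and> gen_cod \<O> e \<in> contour_objs \<O>"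
  by (cases e) (auto simp: contour_gens_def contour_objs_def Out_Col Ins_nth_Col)

lemma is_path_single: "e \<in> contour_gens \<O> \<Longrightarrow> is_path \<O> (gen_dom \<O> e) [e] (gen_cod \<O> e)"
  by (simp add: gen_dom_cod_objs)

lemma is_path_objs: "is_path \<O> x es y \<Longrightarrow> x \<in> contour_objs \<O> \<and> y \<in> contour_objs \<O>"
  by (induction es arbitrary: x) (auto simp: gen_dom_cod_objs)

text \<open>Guarantees that the \<open>pcomp\<close> rule relates two genuine paths with common
  endpoints, so that the classes consist of paths.\<close>

lemma is_path_contour_rhs:
  assumes c: "composable \<O> f i g" and j: "j \<le> arity \<O> (Pcomp \<O> f i g)"
  shows "is_path \<O> (gen_dom \<O> (Pcomp \<O> f i g, j)) (contour_rhs \<O> f i g j)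
    (gen_cod \<O> (Pcomp \<O> f i g, j))"
proof -
  have *: "f \<in> Ops \<O>" "g \<in> Ops \<O>" "i < length (Ins \<O> f)" "Out \<O> g = Ins \<O> f ! i"
    using c by (auto simp: composable_def arity_def)
  define fg where "fg = Pcomp \<O> f i g"
  have out: "Out \<O> fg = Out \<O> f"
    unfolding fg_def using c by (rule Out_Pcomp)
  define n m where "n = arity \<O> f" and "m = arity \<O> g"
  have n: "i < n" "Out \<O> g = Ins \<O> f ! i" "arity \<O> fg = n + m - 1" "j \<le> n + m - 1"
    using * j arity_Pcomp[OF c] by (simp_all add: n_def m_def fg_def arity_def)
  \<comment> \<open>The inputs of the composite are those of \<open>f\<close> before
    \<open>i\<close>, then those of \<open>g\<close>, then the rest of \<open>f\<close>. In the last
    branch \<open>k\<close> is at least \<open>i + m\<close>, so \<open>k + 1 - m\<close> is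
    exact.\<close>
  have ins: "Ins \<O> fg ! k =
      (if k < i then Ins \<O> f ! k else if k < i + m then Ins \<O> g ! (k - i)
       else Ins \<O> f ! (k + 1 - m))" if "k < n + m - 1" for k
    using that * by (auto simp: fg_def Ins_Pcomp[OF c] nth_append n_def m_def arity_def Suc_diff_le)
  have gens: "(f, k) \<in> contour_gens \<O> \<longleftrightarrow> k \<le> n" "(g, k) \<in> contour_gens \<O> \<longleftrightarrow> k \<le> m" for k
    using * by (simp_all add: contour_gens_def n_def m_def)
  have objs: "gen_cod \<O> (f, k) \<in> contour_objs \<O> " if "k \<le> n" for k
    using that gens gen_dom_cod_objs[of "(f, k)"] by (simp del: gen_dom.simps gen_cod.simps)
  have objs': "gen_cod \<O> (g, k) \<in> contour_objs \<O> " if "k \<le> m" for k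
    using that gens gen_dom_cod_objs[of "(g, k)"] by (simp del: gen_dom.simps gen_cod.simps)
  note simps = contour_rhs_def Let_def n_def[symmetric] m_def[symmetric] gens n(2,3) ins out
  have "is_path \<O> (gen_dom \<O> (fg, j)) (contour_rhs \<O> f i g j) (gen_cod \<O> (fg, j))"
  proof (cases "m = 0")
    case True
    consider "j < i" | "j = i" | "j > i" by linarith
    then show ?thesis
    proof cases
      case 1
      then show ?thesis using True n(1,4) objs[of j] by (auto simp: simps)
    next
      case 2
      then show ?thesis using True n(1,4) objs[of "Suc i"] by (auto simp: simps)
    next
      case 3
      then show ?thesis using True n(1,4) objs[of "Suc j"] by (auto simp: simps) 
    qed
  next
    case False
    consider "j < i" | "j = i" | "i < j" "j < i + m" | "j = i + m" | "j > i + m" by linarith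
    then show ?thesis
    proof cases
      case 1
      then show ?thesis using False n(1,4) objs[of j] by (auto simp: simps)
    next
      case 2
      then show ?thesis using False n(1,4) objs'[of 0] by (auto simp: simps)
    next
      case 3
      then show ?thesis using False n(1,4) objs'[of "j - i"] by (auto simp: simps)
    next
      case 4
      then show ?thesis using False n(1,4) objs[of "Suc i"] by (auto simp: simps)
    next
      case 5
      \<comment> \<open>Writing \<open>j\<close> as \<open>Suc (m + k)\<close> eliminates the
        natural subtraction in \<open>j - m + 1\<close>.\<close>
      then obtain k where "j = Suc (m + k)" "i \<le> k" by (auto dest!: less_imp_Suc_add)
      then show ?thesis using False n(1,4) objs[of "Suc (Suc k)"] by (auto simp: simps)
    qed
  qed
  then show ?thesis by (simp only: fg_def)
qed

text \<open>Related paths are parallel. This makes domain and codomain well defined on classes and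
  keeps arbitrary representatives composable.\<close>

lemma contour_cong_paths:
  assumes "(p, q) \<in> contour_cong \<O>"
  shows "p \<in> contour_paths \<O> \<and> q \<in> contour_paths \<O> \<and>
    fst p = fst q \<and> snd (snd p) = snd (snd q)"
  using assms
proof induction
  case (append x es y es' ds z ds')
  then show ?case by (auto simp: contour_paths_def intro: is_path_append)
next
  case (id_up R)
  then show ?case
    by (auto simp: contour_paths_def contour_objs_def contour_gens_def Oid_Ops Out_Oid Ins_Oid arity_Oid)
next
  case (id_down R)
  then show ?case
    by (auto simp: contour_paths_def contour_objs_def contour_gens_def Oid_Ops Out_Oid Ins_Oid arity_Oid)
next
  case (pcomp f i g j x y)
  have "(Pcomp \<O> f i g, j) \<in> contour_gens \<O>"
    using pcomp by (simp add: contour_gens_def Pcomp_Ops)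
  then show ?case
    using pcomp is_path_contour_rhs[of f i g j] is_path_single[of "(Pcomp \<O> f i g, j)"]
    by (simp add: contour_paths_def del: is_path.simps gen_dom.simps gen_cod.simps)
qed (auto simp: contour_paths_def)

lemma equiv_contour_cong: "equiv (contour_paths \<O>) (contour_cong \<O>)"
proof (rule equivI)
  show "contour_cong \<O> \<subseteq> contour_paths \<O> \<times> contour_paths \<O>"
    using contour_cong_paths by auto
  show "refl_on (contour_paths \<O>) (contour_cong \<O>)"
    by (rule refl_onI) (rule contour_cong.refl)
  show "sym (contour_cong \<O>)"
    by (rule symI) (rule contour_cong.sym)
  show "trans (contour_cong \<O>)"
    by (rule transI) (rule contour_cong.trans)
qed

section \<open>Arrows as classes of paths\<close>

lemma contour_class_eq_iff:
  "is_path \<O> x es y \<Longrightarrow> is_path \<O> x' es' y' \<Longrightarrow>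
    contour_class \<O> (x, es, y) = contour_class \<O> (x', es', y') \<longleftrightarrow>
    ((x, es, y), (x', es', y')) \<in> contour_cong \<O>"
  unfolding contour_class_def
  by (rule eq_equiv_class_iff[OF equiv_contour_cong]) (auto simp: contour_paths_def)

lemma contour_class_refl: "is_path \<O> x es y \<Longrightarrow> (x, es, y) \<in> contour_class \<O> (x, es, y)"
  by (auto simp: contour_class_def contour_paths_def intro: contour_cong.refl)

lemma contour_class_Arr: "is_path \<O> x es y \<Longrightarrow> contour_class \<O> (x, es, y) \<in> Arr (contour \<O>)"
  by (auto simp: contour_simps contour_class_def contour_paths_def intro!: quotientI)

lemma contour_ArrE:
  assumes "X \<in> Arr (contour \<O>)"
  obtains x es y where "is_path \<O> x es y" "X = contour_class \<O> (x, es, y)"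
  using assms by (auto simp: contour_simps contour_class_def contour_paths_def elim!: quotientE)

text \<open>The evaluation rule for maps on arrows: \<open>the_elem\<close> returns the intended
  value once the image of the class is a singleton.\<close>

lemma class_val_contour_class:
  assumes "is_path \<O> x es y"
    and "\<And>q. ((x, es, y), q) \<in> contour_cong \<O> \<Longrightarrow> h q = h (x, es, y)"
  shows "class_val h (contour_class \<O> (x, es, y)) = h (x, es, y)"
proof (rule class_val_eq)
  show "(x, es, y) \<in> contour_class \<O> (x, es, y)"
    using assms(1) by (rule contour_class_refl)
  show "h q = h (x, es, y)" if "q \<in> contour_class \<O> (x, es, y)" for q
    using that by (intro assms(2)) (simp add: contour_class_def)
qed

lemma Dom_contour:
  assumes "is_path \<O> x es y"
  shows "Dom (contour \<O>) (contour_class \<O> (x, es, y)) = x"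
proof -
  have "class_val (\<lambda>(x, es, y). x) (contour_class \<O> (x, es, y)) = (\<lambda>(x, es, y). x) (x, es, y)"
  proof (rule class_val_contour_class[OF assms])
    fix q assume "((x, es, y), q) \<in> contour_cong \<O>"
    from contour_cong_paths[OF this]
    show "(\<lambda>(x, es, y). x) q = (\<lambda>(x, es, y). x) (x, es, y)" by (simp add: split_beta)
  qed
  then show ?thesis by (simp add: contour_def)
qed

lemma Cod_contour:
  assumes "is_path \<O> x es y"
  shows "Cod (contour \<O>) (contour_class \<O> (x, es, y)) = y"
proof -
  have "class_val (\<lambda>(x, es, y). y) (contour_class \<O> (x, es, y)) = (\<lambda>(x, es, y). y) (x, es, y)"
  proof (rule class_val_contour_class[OF assms])
    fix q assume "((x, es, y), q) \<in> contour_cong \<O>"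
    from contour_cong_paths[OF this]
    show "(\<lambda>(x, es, y). y) q = (\<lambda>(x, es, y). y) (x, es, y)" by (simp add: split_beta)
  qed
  then show ?thesis by (simp add: contour_def)
qed

text \<open>The \<open>append\<close> rule of the congruence is what makes concatenation independent
  of the representatives.\<close>

lemma Comp_contour:
  assumes "is_path \<O> x es y" "is_path \<O> y ds z"
  shows "Comp (contour \<O>) (contour_class \<O> (x, es, y)) (contour_class \<O> (y, ds, z)) =
    contour_class \<O> (x, es @ ds, z)"
proof -
  define h :: "('c, 'f) contour_path \<times> ('c, 'f) contour_path \<Rightarrow> ('c, 'f) contour_path set" where
    "h = (\<lambda>((x, es, y), (y', ds, z)). contour_class \<O> (x, es @ ds, z))"
  have "class_val h (contour_class \<O> (x, es, y) \<times> contour_class \<O> (y, ds, z)) =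
      h ((x, es, y), (y, ds, z))"
  proof (rule class_val_eq)
    show "((x, es, y), (y, ds, z)) \<in> contour_class \<O> (x, es, y) \<times> contour_class \<O> (y, ds, z)"
      using assms by (simp add: contour_class_refl)
    fix q assume "q \<in> contour_class \<O> (x, es, y) \<times> contour_class \<O> (y, ds, z)"
    then obtain x1 es1 y1 y2 ds1 z1 where q: "q = ((x1, es1, y1), (y2, ds1, z1))"
      and c: "((x, es, y), (x1, es1, y1)) \<in> contour_cong \<O>"
        "((y, ds, z), (y2, ds1, z1)) \<in> contour_cong \<O>"
      by (auto simp: contour_class_def)
    \<comment> \<open>Being parallel to the given paths, the new representatives also meet at
      \<open>y\<close> and can be concatenated.\<close>
    note e = c[THEN contour_cong_paths]
    then have q': "q = ((x, es1, y), (y, ds1, z))" using q by auto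
    then have "((x, es @ ds, z), (x, es1 @ ds1, z)) \<in> contour_cong \<O>"
      using c q by (auto intro: contour_cong.append)
    moreover have "is_path \<O> x (es @ ds) z" "is_path \<O> x (es1 @ ds1) z"
      using assms e q q' by (auto simp: contour_paths_def intro: is_path_append)
    ultimately show "h q = h ((x, es, y), (y, ds, z))"
      by (simp add: q' h_def contour_class_eq_iff[symmetric])
  qed
  then show ?thesis by (simp add: contour_def h_def)
qed

text \<open>On representatives, composition is list concatenation, which is strictly associative and
  unital; the axioms descend to classes.\<close>

lemma contour_category: "category (contour \<O>)"
proof
  fix X assume "X \<in> Arr (contour \<O>)"
  then obtain x es y where X: "is_path \<O> x es y" "X = contour_class \<O> (x, es, y)"
    by (rule contour_ArrE)
  note xy = is_path_objs[OF X(1)]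
  show "Dom (contour \<O>) X \<in> Obj (contour \<O>)" "Cod (contour \<O>) X \<in> Obj (contour \<O>)"
    using X xy by (simp_all add: Dom_contour Cod_contour contour_simps)
  show "Comp (contour \<O>) (Idn (contour \<O>) (Dom (contour \<O>) X)) X = X"
    "Comp (contour \<O>) X (Idn (contour \<O>) (Cod (contour \<O>) X)) = X"
    using X xy Comp_contour[of x "[]" x es y] Comp_contour[of x es y "[]" y]
    by (simp_all add: Dom_contour Cod_contour contour_simps)
next
  fix A assume "A \<in> Obj (contour \<O>)"
  then have "is_path \<O> A [] A" by (simp add: contour_simps)
  then show "Idn (contour \<O>) A \<in> Arr (contour \<O>)" "Dom (contour \<O>) (Idn (contour \<O>) A) = A"
    "Cod (contour \<O>) (Idn (contour \<O>) A) = A"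
    unfolding contour_simps(3) by (simp_all only: contour_class_Arr Dom_contour Cod_contour)
next
  fix X Y assume XY: "X \<in> Arr (contour \<O>)" "Y \<in> Arr (contour \<O>)"
    "Cod (contour \<O>) X = Dom (contour \<O>) Y"
  obtain x es y where X: "is_path \<O> x es y" "X = contour_class \<O> (x, es, y)"
    using XY contour_ArrE by blast
  obtain y' ds z where "is_path \<O> y' ds z" "Y = contour_class \<O> (y', ds, z)"
    using XY contour_ArrE by blast
  with X XY have Y: "is_path \<O> y ds z" "Y = contour_class \<O> (y, ds, z)"
    by (auto simp: Dom_contour Cod_contour)
  have "is_path \<O> x (es @ ds) z" using X Y by (auto intro: is_path_append)
  then show "Comp (contour \<O>) X Y \<in> Arr (contour \<O>)"
    "Dom (contour \<O>) (Comp (contour \<O>) X Y) = Dom (contour \<O>) X"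
    "Cod (contour \<O>) (Comp (contour \<O>) X Y) = Cod (contour \<O>) Y"
    using X Y by (simp_all add: Comp_contour contour_class_Arr Dom_contour Cod_contour)
  fix Z assume Z': "Z \<in> Arr (contour \<O>)" "Cod (contour \<O>) Y = Dom (contour \<O>) Z"
  obtain z' cs u where "is_path \<O> z' cs u" "Z = contour_class \<O> (z', cs, u)"
    using Z' contour_ArrE by blast
  with Y Z' have Z: "is_path \<O> z cs u" "Z = contour_class \<O> (z, cs, u)"
    by (auto simp: Dom_contour Cod_contour)
  show "Comp (contour \<O>) (Comp (contour \<O>) X Y) Z = Comp (contour \<O>) X (Comp (contour \<O>) Y Z)"
    using X Y Z by (simp add: Comp_contour is_path_append[where y = y] is_path_append[where y = z])
qed

section \<open>Generators and relations as arrows\<close>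

lemma contour_gen_arrow:
  assumes "f \<in> Ops \<O>" "i \<le> arity \<O> f"
  shows "contour_gen \<O> f i \<in> Arr (contour \<O>)"
    "Dom (contour \<O>) (contour_gen \<O> f i) = gen_dom \<O> (f, i)"
    "Cod (contour \<O>) (contour_gen \<O> f i) = gen_cod \<O> (f, i)"
proof -
  have "(f, i) \<in> contour_gens \<O>" using assms by (simp add: contour_gens_def)
  note p = is_path_single[OF this]
  show "contour_gen \<O> f i \<in> Arr (contour \<O>)"
    "Dom (contour \<O>) (contour_gen \<O> f i) = gen_dom \<O> (f, i)"
    "Cod (contour \<O>) (contour_gen \<O> f i) = gen_cod \<O> (f, i)"
    unfolding contour_gen_def by (rule contour_class_Arr[OF p] Dom_contour[OF p] Cod_contour[OF p])+
qed

lemma arrow_path_gens: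
  "is_path \<O> x es y \<Longrightarrow> arrow_path (contour \<O>) x (map (\<lambda>(f, i). contour_gen \<O> f i) es) y"
proof (induction es arbitrary: x)
  case (Cons e es)
  obtain f i where "e = (f, i)" by (cases e)
  then show ?case
    using Cons contour_gen_arrow[of f i]
    by (simp add: contour_gens_def del: gen_dom.simps gen_cod.simps)
qed (simp add: contour_simps)

text \<open>A generator is the class of a one-step path and composition is concatenation, so the
  generators generate: every arrow is a composite of them.\<close>

lemma path_comp_gens:
  "is_path \<O> x es y \<Longrightarrow>
    path_comp (contour \<O>) x (map (\<lambda>(f, i). contour_gen \<O> f i) es) = contour_class \<O> (x, es, y)"
proof (induction es arbitrary: x)
  case Nil
  then show ?case by (auto simp: path_comp_Nil contour_simps)
next
  case (Cons e es)
  interpret c: category "contour \<O>" by (rule contour_category)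
  obtain f i where e: "e = (f, i)" by (cases e)
  have ei: "f \<in> Ops \<O>" "i \<le> arity \<O> f" "x = gen_dom \<O> (f, i)" "is_path \<O> (gen_cod \<O> (f, i)) es y"
    using Cons.prems by (simp_all add: e contour_gens_def)
  note p = is_path_single[of "(f, i)"]
  have gens: "(f, i) \<in> contour_gens \<O>" using ei by (simp add: contour_gens_def)
  have "path_comp (contour \<O>) x (map (\<lambda>(f, i). contour_gen \<O> f i) ([(f, i)] @ es)) =
      Comp (contour \<O>) (contour_gen \<O> f i) (contour_class \<O> (gen_cod \<O> (f, i), es, y))"
    using c.path_comp_append[OF arrow_path_gens[OF p[OF gens]] arrow_path_gens[OF ei(4)]]
      Cons.IH[OF ei(4)] contour_gen_arrow[OF ei(1,2)]
    by (simp add: ei(3) c.path_comp_single del: gen_dom.simps gen_cod.simps)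
  also have "\<dots> = contour_class \<O> (x, [(f, i)] @ es, y)"
    unfolding contour_gen_def ei(3) by (rule Comp_contour[OF p[OF gens] ei(4)])
  finally show ?case by (simp add: e)
qed

lemma contour_gen_Oid:
  assumes "R \<in> Col \<O>"
  shows "contour_gen \<O> (Oid \<O> R) 0 = Idn (contour \<O>) (Up R)"
    and "contour_gen \<O> (Oid \<O> R) 1 = Idn (contour \<O>) (Down R)"
proof -
  note c = contour_cong.id_up[OF assms] contour_cong.id_down[OF assms]
  show "contour_gen \<O> (Oid \<O> R) 0 = Idn (contour \<O>) (Up R)"
    "contour_gen \<O> (Oid \<O> R) 1 = Idn (contour \<O>) (Down R)"
    using c[THEN equiv_class_eq[OF equiv_contour_cong]] assms
    by (simp_all add: contour_gen_def contour_class_def contour_simps Out_Oid Ins_Oid arity_Oid)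
qed

text \<open>The \<open>pcomp\<close> rule as an equation between arrows, in the form that can be
  matched with \<open>splice_comp_nth_path\<close>.\<close>

lemma contour_gen_Pcomp:
  assumes c: "composable \<O> f i g" and j: "j \<le> arity \<O> (Pcomp \<O> f i g)"
  shows "contour_gen \<O> (Pcomp \<O> f i g) j =
    path_comp (contour \<O>) (gen_dom \<O> (Pcomp \<O> f i g, j))
      (map (\<lambda>(f, k). contour_gen \<O> f k) (contour_rhs \<O> f i g j))"
  unfolding path_comp_gens[OF is_path_contour_rhs[OF assms]]
  using contour_cong.pcomp[OF assms HOL.refl HOL.refl, THEN equiv_class_eq[OF equiv_contour_cong]]
  by (simp add: contour_gen_def contour_class_def del: gen_dom.simps gen_cod.simps)

section \<open>The unit as a functor of operads\<close>

lemma contour_unit_functor: "operad_functor \<O> (spliced (contour \<O>)) (contour_unit \<O>)"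
proof -
  interpret c: category "contour \<O>" by (rule contour_category)
  interpret s: operad "spliced (contour \<O>)" by (rule c.spliced_operad)
  \<comment> \<open>A total version of the unit on operations, free of the restriction to
    \<open>Ops \<O>\<close>.\<close>
  define \<eta> where "\<eta> f = map (contour_gen \<O> f) [0..<Suc (arity \<O> f)]" for f
  have \<eta>: "on_ops (contour_unit \<O>) f = \<eta> f" if "f \<in> Ops \<O>" for f
    using that by (simp add: contour_unit_def \<eta>_def)
  have len: "length (\<eta> f) = Suc (arity \<O> f)" and nth: "i \<le> arity \<O> f \<Longrightarrow> \<eta> f ! i = contour_gen \<O> f i"
    for f i
    by (simp_all add: \<eta>_def nth_map_upt del: upt_Suc)
  have ops: "\<eta> f \<in> Ops (spliced (contour \<O>))" if "f \<in> Ops \<O>" for f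
    using that by (auto simp: spliced_simps \<eta>_def contour_gen_arrow simp del: upt_Suc)
  have ins: "Ins (spliced (contour \<O>)) (\<eta> f) = map (on_col (contour_unit \<O>)) (Ins \<O> f)"
    if "f \<in> Ops \<O>" for f
    using that by (intro nth_equalityI)
      (auto simp: length_Ins_spliced len arity_def Ins_spliced_nth nth contour_gen_arrow
        contour_unit_def Ins_nth_Col)
  have out: "Out (spliced (contour \<O>)) (\<eta> f) = on_col (contour_unit \<O>) (Out \<O> f)"
    if "f \<in> Ops \<O>" for f
  proof -
    have "\<eta> f \<noteq> []" by (simp add: \<eta>_def)
    then show ?thesis
      using that len[of f] by (simp add: spliced_simps hd_conv_nth last_conv_nth nth
          contour_gen_arrow contour_unit_def Out_Col)
  qed
  have comp: "\<eta> (Pcomp \<O> f i g) = splice_comp (contour \<O>) (\<eta> f) i (\<eta> g)"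
    if c: "composable \<O> f i g" for f i g
  proof (rule nth_equalityI)
    have fg: "f \<in> Ops \<O>" "g \<in> Ops \<O>" "i < arity \<O> f" "Out \<O> g = Ins \<O> f ! i"
      using c by (auto simp: composable_def)
    have c': "composable (spliced (contour \<O>)) (\<eta> f) i (\<eta> g)"
      using fg by (simp add: composable_def ops ins out arity_def)
    have "\<eta> g \<noteq> []" by (simp add: \<eta>_def)
    then show len': "length (\<eta> (Pcomp \<O> f i g)) = length (splice_comp (contour \<O>) (\<eta> f) i (\<eta> g))"
      using fg by (simp add: length_splice_comp len arity_Pcomp[OF c])
    fix j assume "j < length (\<eta> (Pcomp \<O> f i g))"
    then have j: "j \<le> arity \<O> (Pcomp \<O> f i g)" "j < length (splice_comp (contour \<O>) (\<eta> f) i (\<eta> g))"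
      using len' by (simp_all add: len)
    \<comment> \<open>Entry \<open>k\<close> of \<open>\<eta> f\<close> is the generator
      \<open>(f, k)\<close>, so the splice and the relation call for the same word of generators.
      The bound on \<open>j\<close> keeps every index within the arity.\<close>
    have rhs: "map (\<lambda>(u, k). u ! k) (contour_rhs (spliced (contour \<O>)) (\<eta> f) i (\<eta> g) j) =
        map (\<lambda>(f, k). contour_gen \<O> f k) (contour_rhs \<O> f i g j)"
      using contour_rhs_map[of "spliced (contour \<O>)" \<eta> g \<O> f i j] fg j(1)
      by (auto simp: arity_spliced len contour_rhs_def Let_def nth arity_Pcomp[OF c])
    let ?w = "splice_comp (contour \<O>) (\<eta> f) i (\<eta> g)"
    show "\<eta> (Pcomp \<O> f i g) ! j = ?w ! j"
      using c.splice_comp_nth_path[OF c' j(2)] arrow_path_gens[OF is_path_contour_rhs[OF c j(1)]]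
        contour_gen_Pcomp[OF c j(1)] rhs j(1)
      by (simp add: nth)
  qed
  show ?thesis
  proof
    show "on_col (contour_unit \<O>) \<in> Col \<O> \<rightarrow>\<^sub>E Col (spliced (contour \<O>))"
      by (auto simp: contour_unit_def spliced_simps contour_simps contour_objs_def)
    show "on_ops (contour_unit \<O>) \<in> Ops \<O> \<rightarrow>\<^sub>E Ops (spliced (contour \<O>))"
      using ops by (auto simp: contour_unit_def \<eta>_def simp del: upt_Suc)
    show "on_ops (contour_unit \<O>) (Oid \<O> R) =
        Oid (spliced (contour \<O>)) (on_col (contour_unit \<O>) R)" if "R \<in> Col \<O>" for R
      using that contour_gen_Oid[OF that]
      by (simp add: \<eta> Oid_Ops \<eta>_def arity_Oid spliced_simps contour_unit_def)
  qed (auto simp: \<eta> ins out comp Pcomp_Ops spliced_simps(5) composable_def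
      dest: Pcomp_Ops[unfolded composable_def])
qed

end

section \<open>Equality and composition of functors\<close>

lemma category_functor_eqI:
  assumes "category_functor \<C> \<D> F" "category_functor \<C> \<D> G"
    and "\<And>x. x \<in> Obj \<C> \<Longrightarrow> on_obj F x = on_obj G x"
    and "\<And>f. f \<in> Arr \<C> \<Longrightarrow> on_arr F f = on_arr G f"
  shows "F = G"
proof -
  interpret F: category_functor \<C> \<D> F by fact
  interpret G: category_functor \<C> \<D> G by fact
  have "on_obj F = on_obj G" "on_arr F = on_arr G"
    using PiE_ext[OF F.on_obj G.on_obj] PiE_ext[OF F.on_arr G.on_arr] assms(3,4) by blast+
  then show ?thesis by (cases F; cases G) simp
qed

lemma operad_functor_eqI:
  assumes "operad_functor \<O> \<P> F" "operad_functor \<O> \<P> G"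
    and "\<And>R. R \<in> Col \<O> \<Longrightarrow> on_col F R = on_col G R"
    and "\<And>f. f \<in> Ops \<O> \<Longrightarrow> on_ops F f = on_ops G f"
  shows "F = G"
proof -
  interpret F: operad_functor \<O> \<P> F by fact
  interpret G: operad_functor \<O> \<P> G by fact
  have "on_col F = on_col G" "on_ops F = on_ops G"
    using PiE_ext[OF F.on_col G.on_col] PiE_ext[OF F.on_ops G.on_ops] assms(3,4) by blast+
  then show ?thesis by (cases F; cases G) simp
qed

lemma category_functor_id: "category \<C> \<Longrightarrow> category_functor \<C> \<C> (id_functor \<C>)"
  by (auto simp: category_functor_def category_functor_axioms_def id_functor_def category.Dom_Obj
      category.Cod_Obj category.Idn_Arr category.Comp_Arr)

lemma operad_functor_id:
  assumes "operad \<O>"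
  shows "operad_functor \<O> \<O> (id_operad_functor \<O>)"
proof -
  interpret operad \<O> by fact
  have "map (\<lambda>R\<in>Col \<O>. R) (Ins \<O> f) = Ins \<O> f" if "f \<in> Ops \<O>" for f
    using Ins_Col[OF that] by (intro map_idI) auto
  moreover have "f \<in> Ops \<O> \<and> g \<in> Ops \<O>" if "composable \<O> f i g" for f i g
    using that by (simp add: composable_def)
  ultimately show ?thesis
    by unfold_locales (auto simp: id_operad_functor_def Oid_Ops Out_Col Pcomp_Ops)
qed

lemma (in category_functor) functor_closed:
  "x \<in> Obj \<C> \<Longrightarrow> on_obj F x \<in> Obj \<D>" "f \<in> Arr \<C> \<Longrightarrow> on_arr F f \<in> Arr \<D>"
  using on_obj on_arr by auto

lemma (in operad_functor) functor_closed:
  "R \<in> Col \<O> \<Longrightarrow> on_col F R \<in> Col \<P>" "f \<in> Ops \<O> \<Longrightarrow> on_ops F f \<in> Ops \<P>"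
  using on_col on_ops by auto

lemma (in operad_functor) map_arity: "f \<in> Ops \<O> \<Longrightarrow> arity \<P> (on_ops F f) = arity \<O> f"
  by (simp add: arity_def map_Ins)

lemma (in operad_functor) map_composable:
  "composable \<O> f i g \<Longrightarrow> composable \<P> (on_ops F f) i (on_ops F g)"
  by (auto simp: composable_def functor_closed map_arity map_Ins map_Out arity_def)

lemma category_functor_comp:
  assumes "category_functor \<C> \<D> F" "category_functor \<D> \<E> G"
  shows "category_functor \<C> \<E> (comp_functor \<C> F G)"
proof -
  interpret F: category_functor \<C> \<D> F by fact
  interpret G: category_functor \<D> \<E> G by fact
  show ?thesis
    by unfold_locales
      (auto simp: comp_functor_def compose_def F.functor_closed G.functor_closed F.map_Dom F.map_Cod
        G.map_Dom G.map_Cod F.map_Idn G.map_Idn F.map_Comp G.map_Comp F.source.Dom_Obj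
        F.source.Cod_Obj F.source.Idn_Arr F.source.Comp_Arr)
qed

lemma operad_functor_comp:
  assumes "operad_functor \<O> \<P> F" "operad_functor \<P> \<Q> G"
  shows "operad_functor \<O> \<Q> (comp_operad_functor \<O> F G)"
proof -
  interpret F: operad_functor \<O> \<P> F by fact
  interpret G: operad_functor \<P> \<Q> G by fact
  have ins: "map (\<lambda>R\<in>Col \<O>. on_col G (on_col F R)) (Ins \<O> f) = map (on_col G) (map (on_col F) (Ins \<O> f))"
    if "f \<in> Ops \<O>" for f
    using F.source.Ins_Col[OF that] by auto
  have ops: "f \<in> Ops \<O> \<and> g \<in> Ops \<O>" if "composable \<O> f i g" for f i g
    using that by (simp add: composable_def)
  show ?thesis
    by unfold_locales
      (auto simp: comp_operad_functor_def compose_def F.functor_closed G.functor_closed F.map_Ins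
        G.map_Ins F.map_Out G.map_Out F.map_Oid G.map_Oid F.map_Pcomp G.map_Pcomp F.source.Out_Col
        F.source.Oid_Ops F.source.Pcomp_Ops F.map_composable ins ops simp del: map_map)
qed

lemma on_comp_functor:
  "x \<in> Obj \<C> \<Longrightarrow> on_obj (comp_functor \<C> F G) x = on_obj G (on_obj F x)"
  "f \<in> Arr \<C> \<Longrightarrow> on_arr (comp_functor \<C> F G) f = on_arr G (on_arr F f)"
  by (simp_all add: comp_functor_def compose_def)

lemma on_comp_operad_functor:
  "R \<in> Col \<O> \<Longrightarrow> on_col (comp_operad_functor \<O> F G) R = on_col G (on_col F R)"
  "f \<in> Ops \<O> \<Longrightarrow> on_ops (comp_operad_functor \<O> F G) f = on_ops G (on_ops F f)"
  by (simp_all add: comp_operad_functor_def compose_def)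

lemma contour_objsE:
  assumes "x \<in> contour_objs \<O>"
  obtains R where "R \<in> Col \<O>" "x = Up R" | R where "R \<in> Col \<O>" "x = Down R"
  using assms by (auto simp: contour_objs_def)

text \<open>Every arrow is a composite of generators, and functors preserve such composites.
  Agreement on objects also settles the empty paths, whose values are identities.\<close>

lemma contour_functor_eqI:
  assumes "operad \<O>" "category_functor (contour \<O>) \<C> F" "category_functor (contour \<O>) \<C> G"
    and obj: "\<And>x. x \<in> contour_objs \<O> \<Longrightarrow> on_obj F x = on_obj G x"
    and gen: "\<And>f i. f \<in> Ops \<O> \<Longrightarrow> i \<le> arity \<O> f \<Longrightarrow>
      on_arr F (contour_gen \<O> f i) = on_arr G (contour_gen \<O> f i)"
  shows "F = G"
proof (rule category_functor_eqI[OF assms(2,3)])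
  interpret operad \<O> by fact
  interpret F: category_functor "contour \<O>" \<C> F by fact
  interpret G: category_functor "contour \<O>" \<C> G by fact
  show "on_obj F x = on_obj G x" if "x \<in> Obj (contour \<O>)" for x
    using that obj by (simp add: contour_simps)
  fix X assume "X \<in> Arr (contour \<O>)"
  then obtain x es y where p: "is_path \<O> x es y" and X: "X = contour_class \<O> (x, es, y)"
    by (rule contour_ArrE)
  let ?gs = "map (\<lambda>(f, i). contour_gen \<O> f i) es"
  have es: "f \<in> Ops \<O> \<and> i \<le> arity \<O> f" if "(f, i) \<in> set es" for f i
    using set_is_path[OF p] that by (auto simp: contour_gens_def)
  have X': "X = path_comp (contour \<O>) x ?gs"
    by (simp add: X path_comp_gens[OF p])
  have "map (on_arr F) ?gs = map (on_arr G) ?gs"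
    using es gen by auto
  moreover have "on_obj F x = on_obj G x"
    using is_path_objs[OF p] obj by simp
  ultimately show "on_arr F X = on_arr G X"
    unfolding X' F.map_path_comp[OF arrow_path_gens[OF p]] G.map_path_comp[OF arrow_path_gens[OF p]]
    by (simp only:)
qed

section \<open>The functor on the contour category induced by a functor into spliced arrows\<close>

fun ext_obj :: "('c, 'f, 'o \<times> 'o, 'a list) operad_functor_data \<Rightarrow> 'c contour_obj \<Rightarrow> 'o" where
  "ext_obj F (Up R) = fst (on_col F R)"
| "ext_obj F (Down R) = snd (on_col F R)"

definition ext_path ::
  "('o, 'a) cat_data \<Rightarrow> ('c, 'f, 'o \<times> 'o, 'a list) operad_functor_data \<Rightarrow> ('c, 'f) contour_path \<Rightarrow> 'a"
  where
  "ext_path \<C> F = (\<lambda>(x, es, y). path_comp \<C> (ext_obj F x) (map (\<lambda>(f, i). on_ops F f ! i) es))"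

text \<open>The inverse of transposition; see \<open>contour_transpose_bij\<close>.\<close>

definition contour_ext ::
  "('c, 'f) operad_data \<Rightarrow> ('o, 'a) cat_data \<Rightarrow> ('c, 'f, 'o \<times> 'o, 'a list) operad_functor_data \<Rightarrow>
    ('c contour_obj, ('c, 'f) contour_path set, 'o, 'a) functor_data" where
  "contour_ext \<O> \<C> F =
    \<lparr>on_obj = (\<lambda>x\<in>Obj (contour \<O>). ext_obj F x),
     on_arr = (\<lambda>X\<in>Arr (contour \<O>). class_val (ext_path \<C> F) X)\<rparr>"

locale operad_functor_to_spliced = category \<C> + operad_functor \<O> "spliced \<C>" F
  for \<O> :: "('c, 'f) operad_data" and \<C> :: "('o, 'a) cat_data"
    and F :: "('c, 'f, 'o \<times> 'o, 'a list) operad_functor_data"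
begin

lemma length_on_ops: "f \<in> Ops \<O> \<Longrightarrow> length (on_ops F f) = Suc (arity \<O> f)"
  using map_arity[of f] functor_closed(2)[of f] by (auto simp: arity_spliced spliced_simps Suc_diff_le neq_Nil_conv)

lemma ext_gen:
  assumes "f \<in> Ops \<O>" "i \<le> arity \<O> f"
  shows "on_ops F f ! i \<in> Arr \<C>" "Dom \<C> (on_ops F f ! i) = ext_obj F (gen_dom \<O> (f, i))"
    "Cod \<C> (on_ops F f ! i) = ext_obj F (gen_cod \<O> (f, i))"
proof -
  have w: "on_ops F f \<noteq> []" "set (on_ops F f) \<subseteq> Arr \<C>" "length (on_ops F f) = Suc (arity \<O> f)"
    using functor_closed(2)[OF assms(1)] length_on_ops[OF assms(1)] by (auto simp: spliced_simps)
  show "on_ops F f ! i \<in> Arr \<C>" using w assms by auto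
  \<comment> \<open>Gap \<open>k\<close> records the codomain of entry \<open>k\<close> and the
    domain of the next entry. Hence interior domains are read from gap \<open>i - 1\<close>,
    interior codomains from gap \<open>i\<close>, and the two outer ends from the output
    color.\<close>
  have ins: "(Cod \<C> (on_ops F f ! k), Dom \<C> (on_ops F f ! Suc k)) = on_col F (Ins \<O> f ! k)"
    if "k < arity \<O> f" for k
    using that w Ins_spliced_nth[of k "on_ops F f" \<C>] map_Ins[OF assms(1)] by (simp add: arity_def)
  have out: "(Dom \<C> (on_ops F f ! 0), Cod \<C> (on_ops F f ! arity \<O> f)) = on_col F (Out \<O> f)"
    using w map_Out[OF assms(1)] by (simp add: spliced_simps hd_conv_nth last_conv_nth)
  show "Dom \<C> (on_ops F f ! i) = ext_obj F (gen_dom \<O> (f, i))"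
    using ins[of "i - 1"] out assms by (auto simp: prod_eq_iff)
  show "Cod \<C> (on_ops F f ! i) = ext_obj F (gen_cod \<O> (f, i))"
    using ins[of i] out assms by (auto simp: prod_eq_iff)
qed

lemma ext_obj_Obj: "x \<in> contour_objs \<O> \<Longrightarrow> ext_obj F x \<in> Obj \<C>"
  using functor_closed(1) by (fastforce simp: contour_objs_def spliced_simps)

lemma ext_arrow_path:
  "is_path \<O> x es y \<Longrightarrow>
    arrow_path \<C> (ext_obj F x) (map (\<lambda>(f, i). on_ops F f ! i) es) (ext_obj F y)"
proof (induction es arbitrary: x)
  case (Cons e es)
  obtain f i where "e = (f, i)" by (cases e)
  then show ?case
    using Cons ext_gen[of f i] by (simp add: contour_gens_def del: gen_dom.simps gen_cod.simps)
qed (simp add: ext_obj_Obj)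

text \<open>Each generating rule corresponds to an axiom of a functor of operads: the identity rules
  to preservation of identities, \<open>pcomp\<close> to preservation of partial composition. The
  \<open>append\<close> rule holds because values of paths compose.\<close>

lemma ext_path_cong:
  "(p, q) \<in> contour_cong \<O> \<Longrightarrow> ext_path \<C> F p = ext_path \<C> F q"
proof (induction rule: contour_cong.induct)
  case (append x es y es' ds z ds')
  then have "is_path \<O> x es y" "is_path \<O> x es' y" "is_path \<O> y ds z" "is_path \<O> y ds' z"
    using source.contour_cong_paths by (auto simp: contour_paths_def)
  from this[THEN ext_arrow_path] show ?case
    using append.IH by (simp add: ext_path_def path_comp_append)
next
  case (id_up R)
  then have "on_ops F (Oid \<O> R) ! 0 = Idn \<C> (fst (on_col F R))"
    by (cases "on_col F R") (simp add: map_Oid spliced_simps)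
  then show ?case
    using ext_gen[of "Oid \<O> R" 0] id_up
    by (simp add: ext_path_def path_comp_Nil path_comp_single source.Oid_Ops source.Out_Oid)
next
  case (id_down R)
  then have "on_ops F (Oid \<O> R) ! 1 = Idn \<C> (snd (on_col F R))"
    by (cases "on_col F R") (simp add: map_Oid spliced_simps)
  then show ?case
    using ext_gen[of "Oid \<O> R" 1] id_down
    by (simp add: ext_path_def path_comp_Nil path_comp_single source.Oid_Ops source.Ins_Oid
        source.arity_Oid)
next
  case (pcomp f i g j x y)
  let ?h = "on_ops F"
  have ops: "f \<in> Ops \<O>" "g \<in> Ops \<O>" "Pcomp \<O> f i g \<in> Ops \<O>"
    using pcomp source.Pcomp_Ops by (simp_all add: composable_def)
  \<comment> \<open>\<open>F\<close> preserves arities, so the relation for the images takes the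
    same branch as the one for \<open>f\<close> and \<open>g\<close>.\<close>
  have rhs: "map (\<lambda>(u, k). u ! k) (contour_rhs (spliced \<C>) (?h f) i (?h g) j) =
      map (\<lambda>(f, i). ?h f ! i) (contour_rhs \<O> f i g j)"
    using contour_rhs_map[of "spliced \<C>" ?h g \<O> f i j] map_arity[OF ops(2)]
    by (simp add: case_prod_unfold)
  have fg: "?h (Pcomp \<O> f i g) = splice_comp \<C> (?h f) i (?h g)"
    using map_Pcomp[OF pcomp(1)] by (simp add: spliced_simps)
  have "?h (Pcomp \<O> f i g) ! j = path_comp \<C> (ext_obj F x) (map (\<lambda>(f, i). ?h f ! i) (contour_rhs \<O> f i g j))"
    unfolding fg
    using splice_comp_nth_path[OF map_composable[OF pcomp(1)], of j "ext_obj F x" "ext_obj F y"]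
      ext_arrow_path[OF source.is_path_contour_rhs[OF pcomp(1,2)]] length_on_ops[OF ops(3)] pcomp(2-4)
    by (simp add: rhs fg del: gen_dom.simps gen_cod.simps)
  then show ?case
    using ext_gen[OF ops(3) pcomp(2)] pcomp(3)
    by (simp add: ext_path_def path_comp_single del: gen_dom.simps gen_cod.simps)
qed auto

lemma on_arr_contour_ext:
  assumes "is_path \<O> x es y"
  shows "on_arr (contour_ext \<O> \<C> F) (contour_class \<O> (x, es, y)) =
    path_comp \<C> (ext_obj F x) (map (\<lambda>(f, i). on_ops F f ! i) es)"
proof -
  have "class_val (ext_path \<C> F) (contour_class \<O> (x, es, y)) = ext_path \<C> F (x, es, y)"
    by (rule source.class_val_contour_class[OF assms]) (rule ext_path_cong[symmetric])
  then show ?thesis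
    using source.contour_class_Arr[OF assms] by (simp add: contour_ext_def ext_path_def)
qed

lemma on_obj_contour_ext:
  "x \<in> contour_objs \<O> \<Longrightarrow> on_obj (contour_ext \<O> \<C> F) x = ext_obj F x"
  by (simp add: contour_ext_def contour_simps)

lemma contour_ext_gen:
  assumes "f \<in> Ops \<O>" "i \<le> arity \<O> f"
  shows "on_arr (contour_ext \<O> \<C> F) (contour_gen \<O> f i) = on_ops F f ! i"
proof -
  have "(f, i) \<in> contour_gens \<O>" using assms by (simp add: contour_gens_def)
  from on_arr_contour_ext[OF source.is_path_single[OF this]] show ?thesis
    using ext_gen[OF assms] by (simp add: contour_gen_def path_comp_single del: gen_dom.simps gen_cod.simps)
qed

lemma contour_ext_functor: "category_functor (contour \<O>) \<C> (contour_ext \<O> \<C> F)"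
proof -
  interpret c: category "contour \<O>" by (rule source.contour_category)
  let ?G = "contour_ext \<O> \<C> F"
  show ?thesis
  proof
    show "on_obj ?G \<in> Obj (contour \<O>) \<rightarrow>\<^sub>E Obj \<C>"
      by (auto simp: contour_ext_def contour_simps ext_obj_Obj)
    have arr: "on_arr ?G X \<in> Arr \<C> \<and> Dom \<C> (on_arr ?G X) = on_obj ?G (Dom (contour \<O>) X) \<and>
        Cod \<C> (on_arr ?G X) = on_obj ?G (Cod (contour \<O>) X)" if X: "X \<in> Arr (contour \<O>)" for X
    proof -
      obtain x es y where p: "is_path \<O> x es y" "X = contour_class \<O> (x, es, y)"
        using X by (rule source.contour_ArrE)
      then show ?thesis
        using path_comp_arrow[OF ext_arrow_path[OF p(1)]] source.is_path_objs[OF p(1)]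
        by (simp add: on_arr_contour_ext source.Dom_contour source.Cod_contour on_obj_contour_ext)
    qed
    then show "on_arr ?G \<in> Arr (contour \<O>) \<rightarrow>\<^sub>E Arr \<C>"
      by (auto simp: contour_ext_def)
    show "Dom \<C> (on_arr ?G X) = on_obj ?G (Dom (contour \<O>) X)"
      "Cod \<C> (on_arr ?G X) = on_obj ?G (Cod (contour \<O>) X)" if "X \<in> Arr (contour \<O>)" for X
      using arr[OF that] by simp_all
    show "on_arr ?G (Idn (contour \<O>) A) = Idn \<C> (on_obj ?G A)" if "A \<in> Obj (contour \<O>)" for A
      using that on_arr_contour_ext[of A "[]" A]
      by (simp add: contour_simps on_obj_contour_ext path_comp_Nil)
    fix X Y assume XY: "X \<in> Arr (contour \<O>)" "Y \<in> Arr (contour \<O>)"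
      "Cod (contour \<O>) X = Dom (contour \<O>) Y"
    obtain x es y where X: "is_path \<O> x es y" "X = contour_class \<O> (x, es, y)"
      using XY source.contour_ArrE by blast
    obtain y' ds z where "is_path \<O> y' ds z" "Y = contour_class \<O> (y', ds, z)"
      using XY source.contour_ArrE by blast
    with X XY have Y: "is_path \<O> y ds z" "Y = contour_class \<O> (y, ds, z)"
      by (auto simp: source.Dom_contour source.Cod_contour)
    show "on_arr ?G (Comp (contour \<O>) X Y) = Comp \<C> (on_arr ?G X) (on_arr ?G Y)"
      using X Y is_path_append[OF X(1) Y(1)]
        path_comp_append[OF ext_arrow_path[OF X(1)] ext_arrow_path[OF Y(1)]]
      by (simp add: source.Comp_contour on_arr_contour_ext)
  qed
qed

end

lemma on_contour_unit:
  assumes "f \<in> Ops \<O>"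
  shows "length (on_ops (contour_unit \<O>) f) = Suc (arity \<O> f)"
    "i \<le> arity \<O> f \<Longrightarrow> on_ops (contour_unit \<O>) f ! i = contour_gen \<O> f i"
  using assms by (simp_all add: contour_unit_def nth_map_upt del: upt_Suc)

lemma on_ops_splice_map:
  "w \<in> Ops (spliced \<C>) \<Longrightarrow> on_ops (splice_map \<C> F) w = map (on_arr F) w"
  by (simp add: splice_map_def)

lemma on_col_splice_map:
  "A \<in> Obj \<C> \<Longrightarrow> B \<in> Obj \<C> \<Longrightarrow> on_col (splice_map \<C> F) (A, B) = (on_obj F A, on_obj F B)"
  by (simp add: splice_map_def spliced_simps)

section \<open>Functoriality, unit and counit\<close>

text \<open>In an adjunction the image of F under the left adjoint corresponds to F followed by the
  unit of the target. Functoriality and the values on generators then come from the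
  extension.\<close>

lemma contour_map_eq_ext:
  assumes "operad_functor \<O> \<P> F"
  shows "contour_map \<O> \<P> F =
    contour_ext \<O> (contour \<P>) (comp_operad_functor \<O> F (contour_unit \<P>))"
    and "operad_functor_to_spliced \<O> (contour \<P>) (comp_operad_functor \<O> F (contour_unit \<P>))"
proof -
  interpret F: operad_functor \<O> \<P> F by fact
  interpret c: category "contour \<P>" by (rule F.target.contour_category)
  let ?E = "comp_operad_functor \<O> F (contour_unit \<P>)"
  interpret E: operad_functor \<O> "spliced (contour \<P>)" ?E
    by (rule operad_functor_comp[OF assms F.target.contour_unit_functor])
  show "operad_functor_to_spliced \<O> (contour \<P>) ?E" ..
  then interpret S: operad_functor_to_spliced \<O> "contour \<P>" ?E .
  let ?m = "map_contour_obj (on_col F)"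
  have obj: "?m x = ext_obj ?E x" if "x \<in> contour_objs \<O>" for x
    using that
    by (cases rule: contour_objsE) (auto simp: on_comp_operad_functor contour_unit_def F.functor_closed)
  \<comment> \<open>The relabeled word must be a path of \<open>\<P>\<close> for
    \<open>path_comp_gens\<close> to identify the composite of its generators with the class named
    in \<open>contour_map\<close>.\<close>
  have path: "is_path \<P> (?m x) (map (\<lambda>(f, i). (on_ops F f, i)) es) (?m y) \<and>
      map ((\<lambda>(f, i). contour_gen \<P> f i) \<circ> (\<lambda>(f, i). (on_ops F f, i))) es =
      map (\<lambda>(f, i). on_ops ?E f ! i) es" if "is_path \<O> x es y" for x es y
    using that
  proof (induction es arbitrary: x)
    case Nil
    then show ?case
      by (auto simp: contour_objs_def F.functor_closed)
  next
    case (Cons e es)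
    obtain f i where e: "e = (f, i)" by (cases e)
    then have f: "f \<in> Ops \<O>" "i \<le> arity \<O> f" "x = gen_dom \<O> (f, i)" "is_path \<O> (gen_cod \<O> (f, i)) es y"
      using Cons.prems by (simp_all add: contour_gens_def)
    have "?m (gen_dom \<O> (f, i)) = gen_dom \<P> (on_ops F f, i)"
      "?m (gen_cod \<O> (f, i)) = gen_cod \<P> (on_ops F f, i)"
      using f(1,2) by (auto simp: F.map_Ins F.map_Out F.map_arity) (auto simp: arity_def)
    then show ?case
      using f Cons.IH[OF f(4)]
      by (simp add: e contour_gens_def F.functor_closed F.map_arity on_comp_operad_functor
          on_contour_unit del: gen_dom.simps gen_cod.simps)
  qed
  \<comment> \<open>Both sides apply \<open>the_elem\<close> to an image of the same set, so
    agreement on paths is enough and independence of representatives need not be shown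
    again.\<close>
  have val: "class_val (\<lambda>(x, es, y). contour_class \<P> (?m x, map (\<lambda>(f, i). (on_ops F f, i)) es, ?m y)) X =
      class_val (ext_path (contour \<P>) ?E) X" if X: "X \<in> Arr (contour \<O>)" for X
  proof -
    have eq: "(\<lambda>(x, es, y). contour_class \<P> (?m x, map (\<lambda>(f, i). (on_ops F f, i)) es, ?m y)) p =
        ext_path (contour \<P>) ?E p" if p: "p \<in> contour_paths \<O>" for p
    proof -
      obtain x es y where p: "p = (x, es, y)" "is_path \<O> x es y"
        using p by (auto simp: contour_paths_def)
      show ?thesis
        using F.target.path_comp_gens[of "?m x" "map (\<lambda>(f, i). (on_ops F f, i)) es" "?m y"]
          path[OF p(2)] obj[of x] F.source.is_path_objs[OF p(2)]
        by (simp add: p ext_path_def)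
    qed
    have "X \<subseteq> contour_paths \<O>"
      using X F.source.contour_cong_paths
      by (auto simp: contour_class_def elim!: F.source.contour_ArrE)
    then show ?thesis
      unfolding class_val_def using eq by (intro arg_cong[where f = the_elem] image_cong) auto
  qed
  show "contour_map \<O> \<P> F = contour_ext \<O> (contour \<P>) ?E"
    unfolding contour_map_def contour_ext_def
    using val obj by (auto simp: contour_simps(1) intro!: restrict_ext)
qed

lemma contour_map_functor:
  assumes "operad_functor \<O> \<P> F"
  shows "category_functor (contour \<O>) (contour \<P>) (contour_map \<O> \<P> F)"
  unfolding contour_map_eq_ext(1)[OF assms]
  by (rule operad_functor_to_spliced.contour_ext_functor[OF contour_map_eq_ext(2)[OF assms]])

lemma contour_map_gen:
  assumes "operad_functor \<O> \<P> F" "f \<in> Ops \<O>" "i \<le> arity \<O> f"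
  shows "on_arr (contour_map \<O> \<P> F) (contour_gen \<O> f i) = contour_gen \<P> (on_ops F f) i"
proof -
  interpret F: operad_functor \<O> \<P> F by fact
  show ?thesis
    using assms operad_functor_to_spliced.contour_ext_gen[OF contour_map_eq_ext(2)[OF assms(1)] assms(2,3)]
    by (simp add: contour_map_eq_ext(1) on_comp_operad_functor on_contour_unit F.functor_closed F.map_arity)
qed

lemma contour_map_obj:
  "R \<in> Col \<O> \<Longrightarrow> on_obj (contour_map \<O> \<P> F) (Up R) = Up (on_col F R)"
  "R \<in> Col \<O> \<Longrightarrow> on_obj (contour_map \<O> \<P> F) (Down R) = Down (on_col F R)"
  by (simp_all add: contour_map_def contour_simps contour_objs_def)

section \<open>Functoriality and naturality\<close>

lemma contour_map_id:
  assumes "operad \<O>"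
  shows "contour_map \<O> \<O> (id_operad_functor \<O>) = id_functor (contour \<O>)"
proof -
  interpret operad \<O> by fact
  note i = operad_functor_id[OF assms]
  show ?thesis
  proof (rule contour_functor_eqI[OF assms contour_map_functor[OF i]
        category_functor_id[OF contour_category]])
    show "on_obj (contour_map \<O> \<O> (id_operad_functor \<O>)) x = on_obj (id_functor (contour \<O>)) x"
      if "x \<in> contour_objs \<O>" for x
      using that by (auto elim!: contour_objsE
          simp: contour_map_obj id_operad_functor_def id_functor_def contour_simps contour_objs_def)
  qed (simp add: contour_map_gen[OF i] id_functor_def contour_gen_arrow, simp add: id_operad_functor_def)
qed

lemma contour_map_comp:
  assumes F: "operad_functor \<O> \<P> F" and G: "operad_functor \<P> \<Q> G"
  shows "contour_map \<O> \<Q> (comp_operad_functor \<O> F G) =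
    comp_functor (contour \<O>) (contour_map \<O> \<P> F) (contour_map \<P> \<Q> G)"
proof -
  interpret F: operad_functor \<O> \<P> F by fact
  note FG = operad_functor_comp[OF F G]
  show ?thesis
  proof (rule contour_functor_eqI[OF F.source.operad_axioms contour_map_functor[OF FG]
        category_functor_comp[OF contour_map_functor[OF F] contour_map_functor[OF G]]])
    fix x assume "x \<in> contour_objs \<O>"
    then show "on_obj (contour_map \<O> \<Q> (comp_operad_functor \<O> F G)) x =
        on_obj (comp_functor (contour \<O>) (contour_map \<O> \<P> F) (contour_map \<P> \<Q> G)) x"
      by (cases rule: contour_objsE)
        (auto simp: on_comp_functor contour_simps contour_objs_def contour_map_obj
          on_comp_operad_functor F.functor_closed)
  next
    fix f i assume "f \<in> Ops \<O>" "i \<le> arity \<O> f"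
    then show "on_arr (contour_map \<O> \<Q> (comp_operad_functor \<O> F G)) (contour_gen \<O> f i) =
        on_arr (comp_functor (contour \<O>) (contour_map \<O> \<P> F) (contour_map \<P> \<Q> G)) (contour_gen \<O> f i)"
      by (simp add: on_comp_functor contour_map_gen[OF FG] contour_map_gen[OF F] contour_map_gen[OF G]
          F.source.contour_gen_arrow F.functor_closed F.map_arity on_comp_operad_functor)
  qed
qed

lemma contour_unit_natural:
  assumes F: "operad_functor \<O> \<P> F"
  shows "comp_operad_functor \<O> F (contour_unit \<P>) =
    comp_operad_functor \<O> (contour_unit \<O>) (splice_map (contour \<O>) (contour_map \<O> \<P> F))"
proof -
  interpret F: operad_functor \<O> \<P> F by fact
  interpret \<eta>: operad_functor \<O> "spliced (contour \<O>)" "contour_unit \<O>"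
    by (rule F.source.contour_unit_functor)
  interpret C: category_functor "contour \<O>" "contour \<P>" "contour_map \<O> \<P> F"
    by (rule contour_map_functor[OF F])
  show ?thesis
  proof (rule operad_functor_eqI[OF operad_functor_comp[OF F F.target.contour_unit_functor]
        operad_functor_comp[OF \<eta>.operad_functor_axioms C.splice_map_functor]])
    fix R assume "R \<in> Col \<O>"
    then show "on_col (comp_operad_functor \<O> F (contour_unit \<P>)) R = on_col (comp_operad_functor \<O>
        (contour_unit \<O>) (splice_map (contour \<O>) (contour_map \<O> \<P> F))) R"
      by (simp add: on_comp_operad_functor contour_unit_def F.functor_closed on_col_splice_map
          contour_simps contour_objs_def contour_map_obj)
  next
    fix f assume f: "f \<in> Ops \<O>"
    show "on_ops (comp_operad_functor \<O> F (contour_unit \<P>)) f = on_ops (comp_operad_functor \<O>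
        (contour_unit \<O>) (splice_map (contour \<O>) (contour_map \<O> \<P> F))) f"
      using f by (intro nth_equalityI) (simp_all add: on_comp_operad_functor on_contour_unit
          F.functor_closed F.map_arity on_ops_splice_map \<eta>.functor_closed contour_map_gen[OF F])
  qed
qed

text \<open>The counit of an adjunction corresponds to the identity of the value of the right
  adjoint, here the identity functor of \<open>spliced \<C>\<close>.\<close>

lemma contour_counit_eq_ext:
  assumes "category \<C>"
  shows "contour_counit \<C> = contour_ext (spliced \<C>) \<C> (id_operad_functor (spliced \<C>))"
    and "operad_functor_to_spliced (spliced \<C>) \<C> (id_operad_functor (spliced \<C>))"
proof -
  interpret category \<C> by fact
  let ?I = "id_operad_functor (spliced \<C>)"
  interpret I: operad_functor "spliced \<C>" "spliced \<C>" ?I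
    by (rule operad_functor_id[OF spliced_operad])
  show "operad_functor_to_spliced (spliced \<C>) \<C> ?I" ..
  have obj: "counit_obj x = ext_obj ?I x" if "x \<in> contour_objs (spliced \<C>)" for x
    using that by (cases rule: contour_objsE) (auto simp: id_operad_functor_def spliced_simps)
  have val: "class_val (\<lambda>(x, es, y). foldl (Comp \<C>) (Idn \<C> (counit_obj x)) (map (\<lambda>(w, i). w ! i) es)) X =
      class_val (ext_path \<C> ?I) X" if X: "X \<in> Arr (contour (spliced \<C>))" for X
  proof -
    have eq: "(\<lambda>(x, es, y). foldl (Comp \<C>) (Idn \<C> (counit_obj x)) (map (\<lambda>(w, i). w ! i) es)) p =
        ext_path \<C> ?I p" if p: "p \<in> contour_paths (spliced \<C>)" for p
    proof -
      obtain x es y where p: "p = (x, es, y)" "is_path (spliced \<C>) x es y"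
        using p by (auto simp: contour_paths_def)
      \<comment> \<open>Every label along a path is an operation, so the restriction in the identity
        functor has no effect on it.\<close>
      have "map (\<lambda>(w, i). w ! i) es = map (\<lambda>(w, i). on_ops ?I w ! i) es"
        using set_is_path[OF p(2)] by (auto simp: contour_gens_def id_operad_functor_def)
      then show ?thesis
        using obj[of x] I.source.is_path_objs[OF p(2)] by (simp add: p ext_path_def path_comp_def del: map_eq_conv)
    qed
    have "X \<subseteq> contour_paths (spliced \<C>)"
      using X I.source.contour_cong_paths
      by (auto simp: contour_class_def elim!: I.source.contour_ArrE)
    then show ?thesis
      unfolding class_val_def using eq by (intro arg_cong[where f = the_elem] image_cong) auto
  qed
  show "contour_counit \<C> = contour_ext (spliced \<C>) \<C> ?I"
    unfolding contour_counit_def contour_ext_def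
    using val obj by (auto simp: contour_simps(1) intro!: restrict_ext)
qed

lemma contour_counit_functor:
  "category \<C> \<Longrightarrow> category_functor (contour (spliced \<C>)) \<C> (contour_counit \<C>)"
  using contour_counit_eq_ext operad_functor_to_spliced.contour_ext_functor by metis

lemma contour_counit_obj:
  assumes "A \<in> Obj \<C>" "B \<in> Obj \<C>"
  shows "on_obj (contour_counit \<C>) (Up (A, B)) = A" "on_obj (contour_counit \<C>) (Down (A, B)) = B"
  using assms by (simp_all add: contour_counit_def contour_simps contour_objs_def spliced_simps)

lemma contour_counit_gen:
  assumes "category \<C>" "w \<in> Ops (spliced \<C>)" "i \<le> arity (spliced \<C>) w"
  shows "on_arr (contour_counit \<C>) (contour_gen (spliced \<C>) w i) = w ! i"
  using operad_functor_to_spliced.contour_ext_gen[OF contour_counit_eq_ext(2)[OF assms(1)] assms(2,3)]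
    assms
  by (simp add: contour_counit_eq_ext(1)) (simp add: id_operad_functor_def)

text \<open>Both sides send the generator \<open>(w, i)\<close> to the image of \<open>w ! i\<close>
  under \<open>F\<close>.\<close>

lemma contour_counit_natural:
  assumes F: "category_functor \<C> \<D> F"
  shows "comp_functor (contour (spliced \<C>))
      (contour_map (spliced \<C>) (spliced \<D>) (splice_map \<C> F)) (contour_counit \<D>) =
    comp_functor (contour (spliced \<C>)) (contour_counit \<C>) F"
proof -
  interpret F: category_functor \<C> \<D> F by fact
  interpret W: operad_functor "spliced \<C>" "spliced \<D>" "splice_map \<C> F"
    by (rule F.splice_map_functor)
  note W = W.operad_functor_axioms
  show ?thesis
  proof (rule contour_functor_eqI[OF F.source.spliced_operad
        category_functor_comp[OF contour_map_functor[OF W]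
          contour_counit_functor[OF F.target.category_axioms]]
        category_functor_comp[OF contour_counit_functor[OF F.source.category_axioms] F]])
    fix x assume "x \<in> contour_objs (spliced \<C>)"
    then show "on_obj (comp_functor (contour (spliced \<C>))
        (contour_map (spliced \<C>) (spliced \<D>) (splice_map \<C> F)) (contour_counit \<D>)) x =
      on_obj (comp_functor (contour (spliced \<C>)) (contour_counit \<C>) F) x"
      by (cases rule: contour_objsE)
        (auto simp: on_comp_functor contour_simps contour_objs_def contour_map_obj spliced_simps
          on_col_splice_map contour_counit_obj F.functor_closed)
  next
    fix w i assume wi: "w \<in> Ops (spliced \<C>)" "i \<le> arity (spliced \<C>) w"
    then have "i < length w" by (cases w) (auto simp: arity_spliced spliced_simps)
    then show "on_arr (comp_functor (contour (spliced \<C>))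
        (contour_map (spliced \<C>) (spliced \<D>) (splice_map \<C> F)) (contour_counit \<D>))
        (contour_gen (spliced \<C>) w i) =
      on_arr (comp_functor (contour (spliced \<C>)) (contour_counit \<C>) F) (contour_gen (spliced \<C>) w i)"
      using wi W.functor_closed(2)[OF wi(1)] W.map_arity[OF wi(1)]
      by (simp add: on_comp_functor contour_map_gen[OF W] W.source.contour_gen_arrow
          contour_counit_gen F.source.category_axioms F.target.category_axioms on_ops_splice_map)
  qed
qed

text \<open>A generator \<open>(f, i)\<close> goes to position \<open>i\<close> of the unit sequence
  of \<open>f\<close>, and the counit reads off the entry there, which is \<open>(f, i)\<close>
  again.\<close>

lemma contour_triangle:
  assumes "operad \<O>"
  shows "comp_functor (contour \<O>)
    (contour_map \<O> (spliced (contour \<O>)) (contour_unit \<O>)) (contour_counit (contour \<O>)) =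
    id_functor (contour \<O>)"
proof -
  interpret operad \<O> by fact
  interpret \<eta>: operad_functor \<O> "spliced (contour \<O>)" "contour_unit \<O>"
    by (rule contour_unit_functor)
  note \<eta> = \<eta>.operad_functor_axioms
  show ?thesis
  proof (rule contour_functor_eqI[OF assms
        category_functor_comp[OF contour_map_functor[OF \<eta>] contour_counit_functor[OF contour_category]]
        category_functor_id[OF contour_category]])
    fix x assume "x \<in> contour_objs \<O>"
    then show "on_obj (comp_functor (contour \<O>) (contour_map \<O> (spliced (contour \<O>)) (contour_unit \<O>))
        (contour_counit (contour \<O>))) x = on_obj (id_functor (contour \<O>)) x"
      by (cases rule: contour_objsE)
        (auto simp: on_comp_functor id_functor_def contour_simps contour_objs_def contour_map_obj
          contour_unit_def contour_counit_obj)
  next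
    fix f i assume "f \<in> Ops \<O>" "i \<le> arity \<O> f"
    then show "on_arr (comp_functor (contour \<O>) (contour_map \<O> (spliced (contour \<O>)) (contour_unit \<O>))
        (contour_counit (contour \<O>))) (contour_gen \<O> f i) =
      on_arr (id_functor (contour \<O>)) (contour_gen \<O> f i)"
      by (simp add: on_comp_functor contour_map_gen[OF \<eta>] contour_gen_arrow id_functor_def
          contour_counit_gen contour_category \<eta>.functor_closed \<eta>.map_arity on_contour_unit)
  qed
qed

section \<open>Transposition and the hom-set bijection\<close>

lemma contour_transpose_functor:
  assumes "operad \<O>" "category_functor (contour \<O>) \<C> G"
  shows "operad_functor \<O> (spliced \<C>) (contour_transpose \<O> G)"
  unfolding contour_transpose_def
  by (rule operad_functor_comp[OF operad.contour_unit_functor category_functor.splice_map_functor])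
    (rule assms)+

lemma on_col_contour_transpose:
  assumes "R \<in> Col \<O>"
  shows "on_col (contour_transpose \<O> G) R = (on_obj G (Up R), on_obj G (Down R))"
  using assms by (simp add: contour_transpose_def on_comp_operad_functor contour_unit_def
      on_col_splice_map contour_simps contour_objs_def)

lemma on_ops_contour_transpose:
  assumes "operad \<O>" "f \<in> Ops \<O>"
  shows "on_ops (contour_transpose \<O> G) f = map (\<lambda>i. on_arr G (contour_gen \<O> f i)) [0..<Suc (arity \<O> f)]"
proof -
  interpret operad \<O> by fact
  interpret \<eta>: operad_functor \<O> "spliced (contour \<O>)" "contour_unit \<O>"
    by (rule contour_unit_functor)
  have "on_ops (contour_transpose \<O> G) f = map (on_arr G) (on_ops (contour_unit \<O>) f)"
    using assms \<eta>.functor_closed(2)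
    by (simp add: contour_transpose_def on_comp_operad_functor on_ops_splice_map)
  then show ?thesis
    using assms by (simp add: contour_unit_def)
qed

text \<open>Transposing the counit is by definition the unit followed by the spliced counit, so this
  is the second triangle identity: the entries of \<open>w\<close> are read off and listed
  again.\<close>

lemma spliced_triangle:
  assumes "category \<C>"
  shows "contour_transpose (spliced \<C>) (contour_counit \<C>) = id_operad_functor (spliced \<C>)"
proof -
  interpret category \<C> by fact
  interpret operad "spliced \<C>" by (rule spliced_operad)
  note o = spliced_operad
  show ?thesis
  proof (rule operad_functor_eqI[OF contour_transpose_functor[OF o contour_counit_functor[OF assms]]
        operad_functor_id[OF o]])
    show "on_col (contour_transpose (spliced \<C>) (contour_counit \<C>)) R =
        on_col (id_operad_functor (spliced \<C>)) R" if "R \<in> Col (spliced \<C>)" for R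
      using that by (auto simp: on_col_contour_transpose)
        (auto simp: spliced_simps contour_counit_obj id_operad_functor_def)
    fix w assume w: "w \<in> Ops (spliced \<C>)"
    then have "length w = Suc (arity (spliced \<C>) w)"
      by (cases w) (auto simp: arity_spliced spliced_simps)
    then show "on_ops (contour_transpose (spliced \<C>) (contour_counit \<C>)) w =
        on_ops (id_operad_functor (spliced \<C>)) w"
      using w by (intro nth_equalityI)
        (auto simp: on_ops_contour_transpose[OF o w] id_operad_functor_def nth_map_upt
          contour_counit_gen[OF assms] simp del: upt_Suc)
  qed
qed

text \<open>Extending and transposing both keep the entries attached to generators: one direction is
  checked on generators, the other on entries of sequences.\<close>

lemma contour_transpose_bij:
  fixes \<O> :: "('c, 'f) operad_data" and \<C> :: "('o, 'a) cat_data"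
  assumes "operad \<O>" "category \<C>"
  shows "bij_betw (contour_transpose \<O>)
    {G. category_functor (contour \<O>) \<C> G} {F. operad_functor \<O> (spliced \<C>) F}"
proof (rule bij_betw_byWitness[where f' = "contour_ext \<O> \<C>"])
  interpret operad \<O> by fact
  have S: "operad_functor_to_spliced \<O> \<C> F" if "operad_functor \<O> (spliced \<C>) F" for F
    using that assms(2) by (simp add: operad_functor_to_spliced_def)
  show *: "contour_transpose \<O> ` {G. category_functor (contour \<O>) \<C> G} \<subseteq>
      {F. operad_functor \<O> (spliced \<C>) F}"
    using contour_transpose_functor[OF assms(1)] by auto
  show **: "contour_ext \<O> \<C> ` {F. operad_functor \<O> (spliced \<C>) F} \<subseteq>
      {G. category_functor (contour \<O>) \<C> G}"
    using S operad_functor_to_spliced.contour_ext_functor by auto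
  show "\<forall>G\<in>{G. category_functor (contour \<O>) \<C> G}. contour_ext \<O> \<C> (contour_transpose \<O> G) = G"
  proof
    fix G :: "('c contour_obj, ('c, 'f) contour_path set, 'o, 'a) functor_data"
    assume "G \<in> {G. category_functor (contour \<O>) \<C> G}"
    then have G: "category_functor (contour \<O>) \<C> G" by simp
    then have T: "operad_functor \<O> (spliced \<C>) (contour_transpose \<O> G)" using * by auto
    interpret T: operad_functor_to_spliced \<O> \<C> "contour_transpose \<O> G" by (rule S[OF T])
    show "contour_ext \<O> \<C> (contour_transpose \<O> G) = G"
    proof (rule contour_functor_eqI[OF assms(1) T.contour_ext_functor G])
      show "on_obj (contour_ext \<O> \<C> (contour_transpose \<O> G)) x = on_obj G x"
        if "x \<in> contour_objs \<O>" for x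
        using that T.on_obj_contour_ext[OF that]
        by (cases rule: contour_objsE) (auto simp: on_col_contour_transpose)
    qed (simp add: T.contour_ext_gen on_ops_contour_transpose[OF assms(1)] nth_map_upt del: upt_Suc)
  qed
  show "\<forall>F\<in>{F. operad_functor \<O> (spliced \<C>) F}. contour_transpose \<O> (contour_ext \<O> \<C> F) = F"
  proof
    fix F :: "('c, 'f, 'o \<times> 'o, 'a list) operad_functor_data"
    assume "F \<in> {F. operad_functor \<O> (spliced \<C>) F}"
    then have F: "operad_functor \<O> (spliced \<C>) F" by simp
    interpret F: operad_functor_to_spliced \<O> \<C> F by (rule S[OF F])
    show "contour_transpose \<O> (contour_ext \<O> \<C> F) = F"
    proof (rule operad_functor_eqI[OF contour_transpose_functor[OF assms(1) F.contour_ext_functor] F])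
      show "on_col (contour_transpose \<O> (contour_ext \<O> \<C> F)) R = on_col F R" if "R \<in> Col \<O>" for R
        using that by (simp add: on_col_contour_transpose F.on_obj_contour_ext contour_objs_def)
      show "on_ops (contour_transpose \<O> (contour_ext \<O> \<C> F)) f = on_ops F f" if "f \<in> Ops \<O>" for f
        using that by (intro nth_equalityI)
          (simp_all add: on_ops_contour_transpose[OF assms(1)] F.length_on_ops nth_map_upt
            F.contour_ext_gen del: upt_Suc)
    qed
  qed
qed

text \<open>Naturality in both variables at once: at position \<open>i\<close> of the image of
  \<open>f\<close>, both sides have K applied to the value of G at the generator
  \<open>(H f, i)\<close>.\<close>

lemma contour_transpose_natural:
  assumes H: "operad_functor \<P> \<O> H" and G: "category_functor (contour \<O>) \<C> G"
    and K: "category_functor \<C> \<D> K"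
  shows "contour_transpose \<P>
      (comp_functor (contour \<P>) (contour_map \<P> \<O> H) (comp_functor (contour \<O>) G K)) =
    comp_operad_functor \<P> H (comp_operad_functor \<O> (contour_transpose \<O> G) (splice_map \<C> K))"
    (is "contour_transpose \<P> ?L = ?R")
proof -
  interpret H: operad_functor \<P> \<O> H by fact
  interpret G: category_functor "contour \<O>" \<C> G by fact
  interpret K: category_functor \<C> \<D> K by fact
  interpret T: operad_functor \<O> "spliced \<C>" "contour_transpose \<O> G"
    by (rule contour_transpose_functor[OF H.target.operad_axioms G])
  interpret CH: category_functor "contour \<P>" "contour \<O>" "contour_map \<P> \<O> H"
    by (rule contour_map_functor[OF H])
  have L: "category_functor (contour \<P>) \<D> ?L"
    by (intro category_functor_comp[OF CH.category_functor_axioms] category_functor_comp[OF G K])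
  show ?thesis
  proof (rule operad_functor_eqI[OF contour_transpose_functor[OF H.source.operad_axioms L]
        operad_functor_comp[OF H operad_functor_comp[OF T.operad_functor_axioms K.splice_map_functor]]])
    fix R assume "R \<in> Col \<P>"
    then show "on_col (contour_transpose \<P> ?L) R = on_col ?R R"
      using H.functor_closed(1)[of R]
      by (simp add: on_col_contour_transpose on_comp_operad_functor on_comp_functor contour_map_obj
          contour_simps contour_objs_def on_col_splice_map G.functor_closed)
  next
    fix f assume f: "f \<in> Ops \<P>"
    note Hf = H.functor_closed(2)[OF f] H.map_arity[OF f]
    have "on_ops ?R f = map (on_arr K) (on_ops (contour_transpose \<O> G) (on_ops H f))"
      using f Hf T.functor_closed(2) by (simp add: on_comp_operad_functor on_ops_splice_map)
    then show "on_ops (contour_transpose \<P> ?L) f = on_ops ?R f"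
      using f Hf
      by (simp add: on_ops_contour_transpose H.source.operad_axioms H.target.operad_axioms
          on_comp_functor contour_map_gen[OF H] H.source.contour_gen_arrow H.target.contour_gen_arrow
          del: upt_Suc)
  qed
qed

text \<open>The adjunction is stated conjunct by conjunct over arbitrary carrier types; the separate
  type variables let source and target of a functor live on different ones.\<close>

theorem mainTheorem2:
  shows
    "\<comment> \<open>the contour category is a functor from operads to categories\<close>
     (\<forall>\<O> :: ('c, 'f) operad_data. operad \<O> \<longrightarrow> category (contour \<O>)) \<and>
     (\<forall>(\<O> :: ('c, 'f) operad_data) (\<P> :: ('c2, 'f2) operad_data) F.
        operad_functor \<O> \<P> F \<longrightarrow>
          category_functor (contour \<O>) (contour \<P>) (contour_map \<O> \<P> F) \<and>
          (\<forall>f\<in>Ops \<O>. \<forall>i\<le>arity \<O> f.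
             on_arr (contour_map \<O> \<P> F) (contour_gen \<O> f i) = contour_gen \<P> (on_ops F f) i)) \<and>
     (\<forall>\<O> :: ('c, 'f) operad_data. operad \<O> \<longrightarrow>
        contour_map \<O> \<O> (id_operad_functor \<O>) = id_functor (contour \<O>)) \<and>
     (\<forall>(\<O> :: ('c, 'f) operad_data) (\<P> :: ('c2, 'f2) operad_data) (\<Q> :: ('c3, 'f3) operad_data) F G.
        operad_functor \<O> \<P> F \<longrightarrow> operad_functor \<P> \<Q> G \<longrightarrow>
          contour_map \<O> \<Q> (comp_operad_functor \<O> F G) =
          comp_functor (contour \<O>) (contour_map \<O> \<P> F) (contour_map \<P> \<Q> G)) \<and>
     \<comment> \<open>spliced arrows are a functor from categories to operads\<close>
     (\<forall>\<C> :: ('o, 'a) cat_data. category \<C> \<longrightarrow> operad (spliced \<C>)) \<and>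
     (\<forall>(\<C> :: ('o, 'a) cat_data) (\<D> :: ('o2, 'a2) cat_data) F.
        category_functor \<C> \<D> F \<longrightarrow>
          operad_functor (spliced \<C>) (spliced \<D>) (splice_map \<C> F)) \<and>
     (\<forall>\<C> :: ('o, 'a) cat_data. category \<C> \<longrightarrow>
        splice_map \<C> (id_functor \<C>) = id_operad_functor (spliced \<C>)) \<and>
     (\<forall>(\<C> :: ('o, 'a) cat_data) (\<D> :: ('o2, 'a2) cat_data) (\<E> :: ('o3, 'a3) cat_data) F G.
        category_functor \<C> \<D> F \<longrightarrow> category_functor \<D> \<E> G \<longrightarrow>
          splice_map \<C> (comp_functor \<C> F G) =
          comp_operad_functor (spliced \<C>) (splice_map \<C> F) (splice_map \<D> G)) \<and>
     \<comment> \<open>the unit is a natural transformation\<close>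
     (\<forall>\<O> :: ('c, 'f) operad_data. operad \<O> \<longrightarrow>
        operad_functor \<O> (spliced (contour \<O>)) (contour_unit \<O>)) \<and>
     (\<forall>(\<O> :: ('c, 'f) operad_data) (\<P> :: ('c2, 'f2) operad_data) F.
        operad_functor \<O> \<P> F \<longrightarrow>
          comp_operad_functor \<O> F (contour_unit \<P>) =
          comp_operad_functor \<O> (contour_unit \<O>) (splice_map (contour \<O>) (contour_map \<O> \<P> F))) \<and>
     \<comment> \<open>the counit is a natural transformation, with the stated values on generators\<close>
     (\<forall>\<C> :: ('o, 'a) cat_data. category \<C> \<longrightarrow>
        category_functor (contour (spliced \<C>)) \<C> (contour_counit \<C>) \<and>
        (\<forall>A\<in>Obj \<C>. \<forall>B\<in>Obj \<C>.
           on_obj (contour_counit \<C>) (Up (A, B)) = A \<and>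
           on_obj (contour_counit \<C>) (Down (A, B)) = B) \<and>
        (\<forall>w\<in>Ops (spliced \<C>). \<forall>i\<le>arity (spliced \<C>) w.
           on_arr (contour_counit \<C>) (contour_gen (spliced \<C>) w i) = w ! i)) \<and>
     (\<forall>(\<C> :: ('o, 'a) cat_data) (\<D> :: ('o2, 'a2) cat_data) F.
        category_functor \<C> \<D> F \<longrightarrow>
          comp_functor (contour (spliced \<C>))
            (contour_map (spliced \<C>) (spliced \<D>) (splice_map \<C> F)) (contour_counit \<D>) =
          comp_functor (contour (spliced \<C>)) (contour_counit \<C>) F) \<and>
     \<comment> \<open>triangle identities\<close>
     (\<forall>\<O> :: ('c, 'f) operad_data. operad \<O> \<longrightarrow>
        comp_functor (contour \<O>)
          (contour_map \<O> (spliced (contour \<O>)) (contour_unit \<O>)) (contour_counit (contour \<O>)) =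
        id_functor (contour \<O>)) \<and>
     (\<forall>\<C> :: ('o, 'a) cat_data. category \<C> \<longrightarrow>
        comp_operad_functor (spliced \<C>)
          (contour_unit (spliced \<C>)) (splice_map (contour (spliced \<C>)) (contour_counit \<C>)) =
        id_operad_functor (spliced \<C>)) \<and>
     \<comment> \<open>the induced natural bijection of hom-sets\<close>
     (\<forall>(\<O> :: ('c, 'f) operad_data) (\<C> :: ('o, 'a) cat_data).
        operad \<O> \<longrightarrow> category \<C> \<longrightarrow>
          bij_betw (contour_transpose \<O>)
            {G. category_functor (contour \<O>) \<C> G} {F. operad_functor \<O> (spliced \<C>) F}) \<and>
     (\<forall>(\<P> :: ('c2, 'f2) operad_data) (\<O> :: ('c, 'f) operad_data)
        (\<C> :: ('o, 'a) cat_data) (\<D> :: ('o2, 'a2) cat_data) H G K.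
        operad_functor \<P> \<O> H \<longrightarrow> category_functor (contour \<O>) \<C> G \<longrightarrow> category_functor \<C> \<D> K \<longrightarrow>
          contour_transpose \<P>
            (comp_functor (contour \<P>) (contour_map \<P> \<O> H) (comp_functor (contour \<O>) G K)) =
          comp_operad_functor \<P> H
            (comp_operad_functor \<O> (contour_transpose \<O> G) (splice_map \<C> K)))"
  by (intro conjI allI impI ballI)
    (simp_all add: operad.contour_category contour_map_functor contour_map_gen contour_map_id
    contour_map_comp category.spliced_operad category_functor.splice_map_functor splice_map_id
    splice_map_comp operad.contour_unit_functor contour_unit_natural contour_counit_functor
    contour_counit_obj contour_counit_gen contour_counit_natural contour_triangle
    spliced_triangle[unfolded contour_transpose_def] contour_transpose_bij contour_transpose_natural)

end
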